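(* Let $G$ be a finite loopless multigraph with maximum degree $\Delta(G) \leq 2$. Then the total graph $T(G)$ is equitably $k$-choosable for each integer $k \geq \Delta(G)+2$. In particular, for every finite simple graph $G$ with $\Delta(G) \leq 2$, $T(G)$ is equitably $k$-choosable for each integer $k \geq \max\{\chi_l(T(G)), \Delta(G)+2\}$.
   Context: Multigraphs may have parallel edges but no loops; all graphs are finite. The total graph $T(G)$ of a (multi)graph $G$ is the simple graph with vertex set $V(G)\cup E(G)$ in which two distinct elements are adjacent if and only if the corresponding elements are adjacent or incident in $G$ (two vertices joined by an edge, two distinct edges sharing an endpoint, or a vertex and an edge having it as an endpoint). A list assignment $L$ for a graph $H$ assigns to each vertex $v$ a set $L(v)$ of colors; it is a $k$-assignment if $|L(v)|=k$ for all $v$. A proper $L$-coloring is a proper coloring $f$ with $f(v)\in L(v)$ for every $v$. The list chromatic number $\chi_l(H)$ is the least $k$ such that $H$ has a proper $L$-coloring whenever all lists of $L$ have size at least $k$. If $L$ is a $k$-assignment for $H$, a proper $L$-coloring of $H$ is equitable if each color is used on at most $\lceil |V(H)|/k\rceil$ vertices. $H$ is equitably $k$-choosable if it has an equitable $L$-coloring for every $k$-assignment $L$. *)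

theory Defs
  imports Complex_Main "Graph_Theory.Pair_Digraph"
begin

record ('v, 'e) mgraph =
  mverts :: "'v set"
  medges :: "'e set"
  ends :: "'e \<Rightarrow> 'v set"

definition multigraph :: "('v, 'e) mgraph \<Rightarrow> bool" where
  "multigraph G \<longleftrightarrow> finite (mverts G) \<and> finite (medges G) \<and>
     (\<forall>e\<in>medges G. ends G e \<subseteq> mverts G \<and> card (ends G e) = 2)"

definition simple_mgraph :: "('v, 'e) mgraph \<Rightarrow> bool" where
  "simple_mgraph G \<longleftrightarrow> multigraph G \<and> inj_on (ends G) (medges G)"

definition degree :: "('v, 'e) mgraph \<Rightarrow> 'v \<Rightarrow> nat" where
  "degree G v = card {e \<in> medges G. v \<in> ends G e}"

(* The graph without vertices is admitted and gets maximum degree 0. *)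
definition max_degree :: "('v, 'e) mgraph \<Rightarrow> nat" where
  "max_degree G = Max (insert 0 (degree G ` mverts G))"

fun total_adj :: "('v, 'e) mgraph \<Rightarrow> 'v + 'e \<Rightarrow> 'v + 'e \<Rightarrow> bool" where
  "total_adj G (Inl u) (Inl v) \<longleftrightarrow> u \<noteq> v \<and> (\<exists>e\<in>medges G. ends G e = {u, v})"
| "total_adj G (Inr e) (Inr f) \<longleftrightarrow> e \<noteq> f \<and> ends G e \<inter> ends G f \<noteq> {}"
| "total_adj G (Inl v) (Inr e) \<longleftrightarrow> v \<in> ends G e"
| "total_adj G (Inr e) (Inl v) \<longleftrightarrow> v \<in> ends G e"

definition total_graph :: "('v, 'e) mgraph \<Rightarrow> ('v + 'e) pair_pre_digraph" where
  "total_graph G =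
     (let V = mverts G <+> medges G
      in \<lparr>pverts = V, parcs = {(x, y). x \<in> V \<and> y \<in> V \<and> total_adj G x y}\<rparr>)"

lemma pair_graph_total_graph:
  assumes "multigraph G"
  shows "pair_graph (total_graph G)"
proof -
  have fin: "finite (mverts G <+> medges G)"
    using assms by (simp add: multigraph_def)
  have irrefl: "\<not> total_adj G x x" for x
    by (cases x) auto
  have sym: "total_adj G x y \<Longrightarrow> total_adj G y x" for x y
    by (cases x; cases y) (auto simp: insert_commute)
  have "finite (parcs (total_graph G))"
    by (rule finite_subset[OF _ finite_cartesian_product[OF fin fin]])
       (auto simp: total_graph_def Let_def)
  then show ?thesis
    using fin irrefl sym
    by unfold_locales
       (auto simp: total_graph_def Let_def symmetric_def arcs_ends_def arc_to_ends_def sym_def)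
qed

(* Graphs H below are meant to be simple graphs in the sense of pair_graph:
   every edge is represented by both of its orientations in parcs H. *)

definition proper_coloring :: "'a pair_pre_digraph \<Rightarrow> ('a \<Rightarrow> 'c) \<Rightarrow> bool" where
  "proper_coloring H f \<longleftrightarrow> (\<forall>(x, y)\<in>parcs H. f x \<noteq> f y)"

definition proper_list_coloring ::
  "'a pair_pre_digraph \<Rightarrow> ('a \<Rightarrow> 'c set) \<Rightarrow> ('a \<Rightarrow> 'c) \<Rightarrow> bool" where
  "proper_list_coloring H L f \<longleftrightarrow> proper_coloring H f \<and> (\<forall>v\<in>pverts H. f v \<in> L v)"

definition list_assignment_of_size ::
  "'a pair_pre_digraph \<Rightarrow> nat \<Rightarrow> ('a \<Rightarrow> 'c set) \<Rightarrow> bool" where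
  "list_assignment_of_size H k L \<longleftrightarrow> (\<forall>v\<in>pverts H. finite (L v) \<and> card (L v) = k)"

(* Colours are natural numbers here. For a finite graph this is no restriction: infinite lists
   may be cut down to finite ones, and finitely many colours embed into nat. *)
definition list_chromatic_number :: "'a pair_pre_digraph \<Rightarrow> nat" where
  "list_chromatic_number H =
     (LEAST k. \<forall>L :: 'a \<Rightarrow> nat set.
        (\<forall>v\<in>pverts H. infinite (L v) \<or> k \<le> card (L v)) \<longrightarrow>
        (\<exists>f. proper_list_coloring H L f))"

definition equitable_list_coloring ::
  "'a pair_pre_digraph \<Rightarrow> nat \<Rightarrow> ('a \<Rightarrow> 'c set) \<Rightarrow> ('a \<Rightarrow> 'c) \<Rightarrow> bool" where
  "equitable_list_coloring H k L f \<longleftrightarrow> proper_list_coloring H L f \<and>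
     (\<forall>c. int (card {v \<in> pverts H. f v = c}) \<le> \<lceil>real (card (pverts H)) / real k\<rceil>)"

(* The type argument is the type the colours are taken from. *)
definition equitably_choosable :: "'c itself \<Rightarrow> 'a pair_pre_digraph \<Rightarrow> nat \<Rightarrow> bool" where
  "equitably_choosable _ H k \<longleftrightarrow>
     (\<forall>L :: 'a \<Rightarrow> 'c set. list_assignment_of_size H k L \<longrightarrow>
        (\<exists>f. equitable_list_coloring H k L f))"

(* The minimum in list_chromatic_number is taken over a nonempty set. *)
lemma list_chromatic_number_exists:
  fixes H :: "'a pair_pre_digraph"
  assumes "pair_graph H"
  shows "\<exists>k. \<forall>L :: 'a \<Rightarrow> nat set.
    (\<forall>v\<in>pverts H. infinite (L v) \<or> k \<le> card (L v)) \<longrightarrow> (\<exists>f. proper_list_coloring H L f)"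
proof (rule exI[of _ "card (pverts H)"], intro allI impI)
  interpret pair_graph H by fact
  fix L :: "'a \<Rightarrow> nat set"
  assume L: "\<forall>v\<in>pverts H. infinite (L v) \<or> card (pverts H) \<le> card (L v)"
  have "\<exists>f. inj_on f S \<and> (\<forall>v\<in>S. f v \<in> L v)" if "finite S" "S \<subseteq> pverts H" for S
    using that
  proof (induction S rule: finite_induct)
    case empty
    then show ?case by simp
  next
    case (insert x S)
    then obtain f where f: "inj_on f S" "\<forall>v\<in>S. f v \<in> L v" by auto
    have "card (f ` S) < card (pverts H)"
      using insert card_image_le[of S f] card_mono[of "pverts H" "insert x S"] by simp
    then have "\<not> L x \<subseteq> f ` S"
      using L insert card_mono[of "f ` S" "L x"] finite_subset[of "L x" "f ` S"] by fastforce
    then obtain c where c: "c \<in> L x" "c \<notin> f ` S" by auto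
    have "inj_on (f(x := c)) (insert x S)"
      using f(1) c(2) insert.hyps(2) by (auto simp: inj_on_def)
    moreover have "\<forall>v\<in>insert x S. (f(x := c)) v \<in> L v"
      using f(2) c(1) by auto
    ultimately show ?case by blast
  qed
  from this[of "pverts H"] obtain f where f: "inj_on f (pverts H)" "\<forall>v\<in>pverts H. f v \<in> L v"
    by auto
  have "f x \<noteq> f y" if "(x, y) \<in> parcs H" for x y
    using that f(1) no_loops[of "(x, y)"] tail_in_verts[of "(x, y)"] head_in_verts[of "(x, y)"]
    by (auto simp: inj_on_def)
  then have "proper_list_coloring H L f"
    using f(2) by (auto simp: proper_list_coloring_def proper_coloring_def)
  then show "\<exists>f. proper_list_coloring H L f" by blast
qed

end

(* Subdividing every edge of G gives a graph S of maximum degree at most 2, and T(G) is the square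
   of S. So S splits into paths and cycles, the cycles having even length.

   For paths, or when k >= 5, the vertices can be listed so that neighbours in the square are fewer
   than k places apart; colouring greedily along blocks of k consecutive places, each vertex avoiding
   the earlier ones of its own block and its earlier neighbours, uses every colour at most once per
   block. For k = 4 each cycle of length m is cut into a head of m mod 4 positions, whose colours
   must avoid those used in excess so far, and rainbow blocks of four. If all lists of the cycle
   agree, a fixed pattern works. Otherwise rotate so that the lists at m - 3 and m - 2 differ; with
   a suitable colour at position 0 the greedy colouring leaves in the last block four lists
   of sizes 2, 3, 3, 2, the two middle ones having at least four colours together, and these have
   distinct representatives. *)

theory Submission
  imports Defs
begin

section \<open>Greedy list colouring along blocks of a linear order\<close>

text \<open>Every new place meets fewer forbidden colours than its list holds, so a colour is left.
  The places below \<open>s\<close> are prescribed by \<open>g\<close> and still act as obstacles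
  for later places; this is how colours can be forbidden in advance.\<close>

lemma greedy_extend:
  fixes L :: "nat \<Rightarrow> 'c set"
  assumes "\<And>p. s \<le> p \<Longrightarrow> p < n \<Longrightarrow> finite (L p) \<and> card {j. j < p \<and> A j p} < card (L p)"
  shows "\<exists>f. (\<forall>p<s. f p = g p) \<and>
    (\<forall>p\<in>{s..<n}. f p \<in> L p \<and> (\<forall>j<p. A j p \<longrightarrow> f j \<noteq> f p))"
  using assms
proof (induction n)
  case 0
  then show ?case by auto
next
  case (Suc n)
  then obtain f where f: "\<forall>p<s. f p = g p"
    "\<forall>p\<in>{s..<n}. f p \<in> L p \<and> (\<forall>j<p. A j p \<longrightarrow> f j \<noteq> f p)"
    by fastforce
  show ?case
  proof (cases "s \<le> n")
    case True
    define B where "B = {j. j < n \<and> A j n}"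
    have "finite B" by (auto simp: B_def)
    then have "card (f ` B) \<le> card B" by (rule card_image_le)
    also have "\<dots> < card (L n)" using Suc.prems[of n] True by (auto simp: B_def)
    finally have "\<not> L n \<subseteq> f ` B"
      using card_mono[of "f ` B" "L n"] \<open>finite B\<close> by auto
    then obtain c where "c \<in> L n" "c \<notin> f ` B" by auto
    then have "(\<forall>p<s. (f(n := c)) p = g p) \<and> (\<forall>p\<in>{s..<Suc n}. (f(n := c)) p \<in> L p \<and>
        (\<forall>j<p. A j p \<longrightarrow> (f(n := c)) j \<noteq> (f(n := c)) p))"
      using f True by (auto simp: B_def less_Suc_eq)
    then show ?thesis by blast
  next
    case False
    then show ?thesis using f by auto
  qed
qed

text \<open>A colour occurs at most once per block of \<open>k\<close> places, so blocks are counted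
  instead: their indices run from \<open>s div k\<close> up to, but not including, n/k rounded
  up.\<close>

lemma block_colour_count:
  fixes f :: "nat \<Rightarrow> 'c"
  assumes "0 < k"
    and "\<And>i j. s \<le> i \<Longrightarrow> i < j \<Longrightarrow> j < n \<Longrightarrow> i div k = j div k \<Longrightarrow> f i \<noteq> f j"
  shows "card {p\<in>{s..<n}. f p = c} \<le> (n + k - 1) div k - s div k"
proof -
  have "inj_on (\<lambda>p. p div k) {p\<in>{s..<n}. f p = c}"
    by (rule inj_onI) (metis (mono_tags, lifting) assms(2) atLeastLessThan_iff linorder_neqE_nat mem_Collect_eq)
  moreover have "(\<lambda>p. p div k) ` {p\<in>{s..<n}. f p = c} \<subseteq> {s div k..<(n + k - 1) div k}"
  proof -
    have "p div k < (n + k - 1) div k" if "p < n" for p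
    proof -
      have "p div k + 1 = (p + k) div k" using \<open>0 < k\<close> by simp
      also have "\<dots> \<le> (n + k - 1) div k" using that by (intro div_le_mono) auto
      finally show ?thesis by simp
    qed
    then show ?thesis by (auto intro: div_le_mono)
  qed
  ultimately have "card {p\<in>{s..<n}. f p = c} \<le> card {s div k..<(n + k - 1) div k}"
    by (intro card_inj_on_le) auto
  then show ?thesis by simp
qed

text \<open>The block of \<open>p\<close> begins \<open>p mod k\<close> places before
  \<open>p\<close>, so all conflicting earlier places are among the last
  \<open>max d (p mod k)\<close> ones, and both numbers are below \<open>k\<close>. Hence lists of
  size \<open>k\<close> suffice for \<open>greedy_extend\<close>.\<close>

lemma card_conflicts:
  fixes d k p :: nat
  assumes "d < k"
  shows "card {j. j < p \<and> (p \<le> j + d \<or> j div k = p div k)} < k"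
proof -
  have "k * (p div k) \<le> j" if "j div k = p div k" for j
    by (metis that times_div_less_eq_dividend)
  then have "p \<le> j + max d (p mod k)" if "p \<le> j + d \<or> j div k = p div k" for j
    using that mult_div_mod_eq[of k p] by (smt (verit) add_le_mono le_trans max.cobounded1 max.cobounded2 order_refl)
  then have "{j. j < p \<and> (p \<le> j + d \<or> j div k = p div k)} \<subseteq> {p - max d (p mod k)..<p}"
    by (auto simp: le_diff_conv)
  then have "card {j. j < p \<and> (p \<le> j + d \<or> j div k = p div k)} \<le> card {p - max d (p mod k)..<p}"
    by (intro card_mono) auto
  also have "\<dots> \<le> max d (p mod k)" by simp
  also have "\<dots> < k" using assms by simp
  finally show ?thesis .
qed

text \<open>This is bandwidth at most \<open>d\<close>, witnessed by the layout
  \<open>pos\<close>.\<close>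

definition banded :: "nat \<Rightarrow> 'a set \<Rightarrow> ('a \<Rightarrow> 'a \<Rightarrow> bool) \<Rightarrow> bool" where
  "banded d V R \<longleftrightarrow> (\<exists>pos. bij_betw pos V {..<card V} \<and>
     (\<forall>x\<in>V. \<forall>y\<in>V. R x y \<longrightarrow> pos x \<le> pos y + d \<and> pos y \<le> pos x + d))"

lemma finite_subset_image_lessThan:
  assumes "finite F" "card F \<le> s"
  shows "\<exists>g :: nat \<Rightarrow> 'c. F \<subseteq> g ` {..<s}"
proof -
  obtain h where h: "bij_betw h {0..<card F} F"
    using ex_bij_betw_nat_finite[OF assms(1)] by blast
  then have "F = h ` {0..<card F}" by (simp add: bij_betw_def)
  also have "\<dots> \<subseteq> h ` {..<s}" using assms(2) by (intro image_mono) auto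
  finally show ?thesis by blast
qed

text \<open>The colours in \<open>F\<close> occupy \<open>s\<close> phantom places at the start of the first block of \<open>k\<close>.\<close>

lemma greedy_banded:
  fixes L :: "'a \<Rightarrow> 'c set"
  assumes V: "finite V" "banded d V R" "d < k"
    and L: "\<And>v. v \<in> V \<Longrightarrow> finite (L v) \<and> card (L v) = k"
    and F: "finite F" "card F \<le> s" "s < k"
    and irrefl: "\<And>x. \<not> R x x"
  shows "\<exists>f. (\<forall>v\<in>V. f v \<in> L v) \<and> (\<forall>x\<in>V. \<forall>y\<in>V. R x y \<longrightarrow> f x \<noteq> f y) \<and>
    (\<forall>c. card {v\<in>V. f v = c} + of_bool (c \<in> F) \<le> (s + card V + k - 1) div k)"
proof -
  obtain pos where bij: "bij_betw pos V {..<card V}"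
    and band: "\<And>x y. x \<in> V \<Longrightarrow> y \<in> V \<Longrightarrow> R x y \<Longrightarrow> pos x \<le> pos y + d \<and> pos y \<le> pos x + d"
    using V(2) unfolding banded_def by blast
  define n where "n = s + card V"
  have pos_less: "pos v < card V" if "v \<in> V" for v
    using bij that by (auto simp: bij_betw_def)
  have pos_inv: "inv_into V pos (pos v) = v" if "v \<in> V" for v
    using bij that by (auto simp: bij_betw_def)
  have inv_mem: "inv_into V pos p \<in> V" if "p < card V" for p
    using bij that by (auto simp: bij_betw_def intro: inv_into_into)
  obtain g :: "nat \<Rightarrow> 'c" where g: "F \<subseteq> g ` {..<s}"
    using finite_subset_image_lessThan[of F s] F by auto
  define M where "M p = L (inv_into V pos (p - s))" for p
  have "finite (M p) \<and> card {j. j < p \<and> (p \<le> j + d \<or> j div k = p div k)} < card (M p)"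
    if "s \<le> p" "p < n" for p
    using that L[of "inv_into V pos (p - s)"] inv_mem[of "p - s"] card_conflicts[OF V(3), of p]
    by (auto simp: M_def n_def)
  from greedy_extend[of s n M "\<lambda>j p. p \<le> j + d \<or> j div k = p div k" g, OF this]
  obtain f where f1: "\<forall>p<s. f p = g p"
    and f2: "\<forall>p\<in>{s..<n}. f p \<in> M p \<and> (\<forall>j<p. p \<le> j + d \<or> j div k = p div k \<longrightarrow> f j \<noteq> f p)"
    by blast
  define h where "h v = f (s + pos v)" for v
  have "h v \<in> L v" if "v \<in> V" for v
    using bspec[OF f2, of "s + pos v"] pos_less[OF that] pos_inv[OF that]
    by (simp add: h_def M_def n_def)
  moreover have "h x \<noteq> h y" if xy: "x \<in> V" "y \<in> V" "R x y" for x y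
  proof -
    have "pos x \<noteq> pos y" using xy irrefl pos_inv by metis
    moreover have "f (s + pos v) \<noteq> f (s + pos w)"
      if "w \<in> V" "pos v < pos w" "pos w \<le> pos v + d" for v w
      using bspec[OF f2, of "s + pos w"] pos_less[OF that(1)] that by (auto simp: n_def)
    ultimately show ?thesis
      using xy band[OF xy] unfolding h_def by (metis linorder_neqE_nat)
  qed
  moreover have "card {v\<in>V. h v = c} + of_bool (c \<in> F) \<le> (s + card V + k - 1) div k" for c
  proof -
    have "bij_betw (\<lambda>v. s + pos v) V {s..<n}"
    proof -
      have "bij_betw (\<lambda>p. s + p) {..<card V} {s..<n}"
        by (rule bij_betw_byWitness[where f' = "\<lambda>p. p - s"]) (auto simp: n_def)
      from bij_betw_trans[OF bij this] show ?thesis by (simp add: o_def)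
    qed
    then have "bij_betw (\<lambda>v. s + pos v) {v\<in>V. h v = c} {p\<in>{s..<n}. f p = c}"
      by (rule bij_betw_subset) (use \<open>bij_betw (\<lambda>v. s + pos v) V {s..<n}\<close> in \<open>auto simp: h_def bij_betw_def\<close>)
    then have card_eq: "card {v\<in>V. h v = c} = card {p\<in>{s..<n}. f p = c}"
      by (rule bij_betw_same_card)
    have distinct: "f i \<noteq> f j" if "s \<le> j" "i < j" "j < n" "i div k = j div k" for i j
      using f2 that by auto
    show ?thesis
    proof (cases "c \<in> F")
      case True
      then obtain i where i: "i < s" "f i = c" using g f1 by force
      \<comment> \<open>The colour already sits on a phantom place of the first block, so all its
        real places lie in later blocks; the block saved pays for the summand
        \<open>of_bool (c \<in> F)\<close>.\<close>
      then have "k \<le> p" if "s \<le> p" "p < n" "f p = c" for p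
        using distinct[of p i] that F(3) by (metis div_less leI less_le_trans order.strict_trans)
      then have "{p\<in>{s..<n}. f p = c} \<subseteq> {p\<in>{k..<n}. f p = c}" by auto
      then have "card {p\<in>{s..<n}. f p = c} \<le> card {p\<in>{k..<n}. f p = c}"
        by (intro card_mono) auto
      also have "\<dots> \<le> (n + k - 1) div k - k div k"
        using F(3) distinct by (intro block_colour_count) auto
      also have "\<dots> + 1 = (n + k - 1) div k"
        using i F(3) by (auto simp: n_def div_greater_zero_iff Suc_leI)
      finally show ?thesis using card_eq True by (simp add: n_def)
    next
      case False
      have "card {p\<in>{s..<n}. f p = c} \<le> (n + k - 1) div k - s div k"
        using V(3) distinct by (intro block_colour_count) auto
      then show ?thesis using card_eq False by (simp add: n_def)
    qed
  qed
  ultimately show ?thesis by blast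
qed

section \<open>Block colourings of squares of even cycles from lists of size four\<close>

text \<open>With \<open>a\<close> and \<open>d\<close> fixed, \<open>b\<close> and \<open>c\<close>
  are chosen independently of each other. If they coincide, the bound on the union supplies a
  further colour \<open>z\<close> in one of the two middle sets, and \<open>z\<close> replaces the
  choice made there.\<close>

lemma distinct_representatives_4:
  fixes A B C D :: "'c set"
  assumes "2 \<le> card A" "3 \<le> card B" "3 \<le> card C" "2 \<le> card D" "4 \<le> card (B \<union> C)"
  shows "\<exists>a\<in>A. \<exists>b\<in>B. \<exists>c\<in>C. \<exists>d\<in>D. distinct [a, b, c, d]"
proof -
  have two: "\<exists>x\<in>S - T. True" if "card T < card S" "finite T" for S T :: "'c set"
    using that card_mono[of T S] by (metis Diff_iff leD subsetI)
  obtain a where a: "a \<in> A" using two[of "{}" A] assms by auto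
  obtain d where d: "d \<in> D" "d \<noteq> a" using two[of "{a}" D] assms by auto
  have le2: "card {a, d} \<le> 2" by (simp add: card_insert_le_m1)
  obtain b where b: "b \<in> B" "b \<notin> {a, d}" using two[of "{a, d}" B] assms le2 by auto
  obtain c where c: "c \<in> C" "c \<notin> {a, d}" using two[of "{a, d}" C] assms le2 by auto
  have "card {a, d, b} \<le> 3" by (simp add: card_insert_le_m1)
  then obtain z where z: "z \<in> B \<union> C" "z \<notin> {a, d, b}"
    using two[of "{a, d, b}" "B \<union> C"] assms by auto
  show ?thesis
  proof (cases "b = c")
    case False
    then show ?thesis using a b c d by (intro bexI[of _ a] bexI[of _ b] bexI[of _ c] bexI[of _ d]) auto
  next
    case True
    show ?thesis
    proof (cases "z \<in> B")
      case True
      then show ?thesis using a z c d \<open>b = c\<close>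
        by (intro bexI[of _ a] bexI[of _ z] bexI[of _ c] bexI[of _ d]) auto
    next
      case False
      then show ?thesis using a z b d \<open>b = c\<close>
        by (intro bexI[of _ a] bexI[of _ b] bexI[of _ z] bexI[of _ d]) auto
    qed
  qed
qed

text \<open>Colourings of the square of a cycle whose first \<open>h\<close> positions form a head avoiding \<open>F\<close>
  and whose remaining positions are cut into rainbow blocks of four.\<close>

definition block_colouring ::
  "nat \<Rightarrow> nat \<Rightarrow> 'c set \<Rightarrow> (nat \<Rightarrow> 'c set) \<Rightarrow> (nat \<Rightarrow> 'c) \<Rightarrow> bool" where
  "block_colouring m h F L f \<longleftrightarrow>
     (\<forall>i<m. f i \<in> L i \<and> f i \<noteq> f ((i + 1) mod m) \<and> f i \<noteq> f ((i + 2) mod m)) \<and>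
     (\<forall>i j. i < j \<longrightarrow> j < m \<longrightarrow> (i + h) div 4 = (j + h) div 4 \<longrightarrow> f i \<noteq> f j) \<and>
     (\<forall>i<h. f i \<notin> F)"

text \<open>Here \<open>h\<close> is 0 or 2. Shifting the positions by \<open>h\<close> turns a
  nonempty head into the second half of block 0 and the rest into complete blocks. A colour outside
  the head thus occurs at most once in each of the \<open>m div 4\<close> complete blocks, and only
  head colours can occur once more.\<close>

lemma block_colouring_count:
  assumes f: "block_colouring m h F L f" and m: "m mod 4 = h" "even m"
  shows "finite (f ` {..<h})" "card (f ` {..<h}) \<le> m mod 4" "f ` {..<h} \<inter> F = {}"
    "card {i\<in>{..<m}. f i = c} \<le> m div 4 + of_bool (c \<in> f ` {..<h})"
proof -
  have h: "h = 0 \<or> h = 2" using m by presburger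
  show "finite (f ` {..<h})" by simp
  show "card (f ` {..<h}) \<le> m mod 4" using m card_image_le[of "{..<h}" f] by simp
  show "f ` {..<h} \<inter> F = {}" using f by (auto simp: block_colouring_def)
  define g where "g p = f (p - h)" for p
  have "bij_betw (\<lambda>i. i + h) {i\<in>{..<m}. f i = c} {p\<in>{h..<h + m}. g p = c}"
    by (rule bij_betw_byWitness[where f' = "\<lambda>p. p - h"]) (auto simp: g_def)
  then have card_eq: "card {i\<in>{..<m}. f i = c} = card {p\<in>{h..<h + m}. g p = c}"
    by (rule bij_betw_same_card)
  have distinct: "g i \<noteq> g j" if "h \<le> i" "i < j" "j < h + m" "i div 4 = j div 4" for i j
  proof -
    have "i - h < j - h" "j - h < m" "(i - h + h) div 4 = (j - h + h) div 4" using that by auto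
    then show ?thesis using f unfolding g_def block_colouring_def by blast
  qed
  obtain q where q: "m = 4 * q + h" using m by (metis mult_div_mod_eq)
  have divs: "m div 4 = q" "(h + m + 4 - 1) div 4 = q + of_bool (h = 2)"
    using h unfolding q by auto
  show "card {i\<in>{..<m}. f i = c} \<le> m div 4 + of_bool (c \<in> f ` {..<h})"
  proof (cases "c \<in> f ` {..<h} \<or> h = 0")
    case True
    have "card {p\<in>{h..<h + m}. g p = c} \<le> (h + m + 4 - 1) div 4 - h div 4"
      using distinct by (intro block_colour_count) auto
    also have "\<dots> \<le> m div 4 + of_bool (c \<in> f ` {..<h})"
      using h True unfolding divs by auto
    finally show ?thesis using card_eq by simp
  next
    case False
    \<comment> \<open>Now \<open>h = 2\<close>, and the shifted places 2 and 3 are the head, from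
      which \<open>c\<close> is absent.\<close>
    have "p - h < h" if "h \<le> p" "p < 4" for p using that False h by auto
    then have "{p\<in>{h..<h + m}. g p = c} \<subseteq> {p\<in>{4..<h + m}. g p = c}"
      using False by (force simp: g_def)
    then have "card {p\<in>{h..<h + m}. g p = c} \<le> card {p\<in>{4..<h + m}. g p = c}"
      by (intro card_mono) auto
    also have "\<dots> \<le> (h + m + 4 - 1) div 4 - 4 div 4"
      using distinct h by (intro block_colour_count) auto
    also have "\<dots> \<le> m div 4" using h False unfolding divs by auto
    finally show ?thesis using card_eq by simp
  qed
qed

lemma two_elements:
  assumes "2 \<le> card S"
  shows "\<exists>a\<in>S. \<exists>b\<in>S. a \<noteq> b"
  using obtain_subset_with_card_n[OF assms] by (metis card_2_iff insert_subset)

text \<open>The colours are \<open>a b\<close> on the head, if there is one, and then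
  \<open>c a b d\<close> repeated. Equal colours are at least four apart inside the repeated part,
  and the order of the pattern keeps both head colours three away from their nearest copies on
  either side, also across the end of the cycle.\<close>

lemma block_colouring_equal_lists:
  fixes X :: "'c set"
  assumes m: "even m" "6 \<le> m" "h = m mod 4"
    and X: "card X = 4" and F: "finite F" "card F \<le> h"
    and L: "\<And>i. i < m \<Longrightarrow> L i = X"
  shows "\<exists>f. block_colouring m h F L f"
proof -
  have h: "h = 0 \<or> h = 2" using m by presburger
  have "finite X" using X card.infinite by fastforce
  then have "2 \<le> card (X - F)" using X F h diff_card_le_card_Diff[of F X] by auto
  then obtain a b where ab: "a \<in> X" "b \<in> X" "a \<notin> F" "b \<notin> F" "a \<noteq> b"
    using two_elements by (metis Diff_iff)
  have "2 \<le> card (X - {a, b})" using X ab by (simp add: card_Diff_subset)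
  then obtain c d where cd: "c \<in> X" "d \<in> X" "c \<notin> {a, b}" "d \<notin> {a, b}" "c \<noteq> d"
    using two_elements by (metis Diff_iff)
  define f where "f i = (if i < h then [a, b] ! i else [c, a, b, d] ! ((i - h) mod 4))" for i
  have mem: "f i \<in> X" for i
  proof (cases "i < h")
    case True
    then have "i = 0 \<or> i = 1" using h by auto
    then show ?thesis using ab True by (auto simp: f_def)
  next
    case False
    have "(i - h) mod 4 < length [c, a, b, d]" by simp
    then have "[c, a, b, d] ! ((i - h) mod 4) \<in> set [c, a, b, d]" by (rule nth_mem)
    then show ?thesis using False ab cd by (auto simp: f_def)
  qed
  have cyc: "f i \<noteq> f ((i + 1) mod m) \<and> f i \<noteq> f ((i + 2) mod m)" if "i < m" for i
  proof -
    have f0: "f 0 = (if h = 0 then c else a)" "f 1 = (if h = 0 then a else b)"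
      using h by (auto simp: f_def)
    have flast: "f (m - 2) = b" "f (m - 1) = d"
    proof -
      obtain q where q: "m = 4 * q + h" using m(3) by (metis mult_div_mod_eq)
      have "1 \<le> q" using q m(2) h by linarith
      then obtain q' where q': "q = Suc q'" by (cases q) simp_all
      have eqs: "m - 2 - h = 4 * q' + 2" "m - 1 - h = 4 * q' + 3" unfolding q q' by simp_all
      have "(m - 2 - h) mod 4 = 2" "(m - 1 - h) mod 4 = 3" unfolding eqs by presburger+
      moreover have "\<not> m - 2 < h" "\<not> m - 1 < h" using eqs by linarith+
      ultimately show "f (m - 2) = b" "f (m - 1) = d" by (simp_all add: f_def)
    qed
    consider "i + 2 < m" "h \<le> i" | "i < h" | "i = m - 2" | "i = m - 1" using \<open>i < m\<close> by linarith
    then show ?thesis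
    proof cases
      case 1
      define x where "x = i - h"
      have "i + 1 - h = x + 1" "i + 2 - h = x + 2" using 1 by (auto simp: x_def)
      then have eqs: "f i = [c, a, b, d] ! (x mod 4)" "f (i + 1) = [c, a, b, d] ! ((x + 1) mod 4)"
        "f (i + 2) = [c, a, b, d] ! ((x + 2) mod 4)"
        using 1 unfolding f_def x_def by (metis add_lessD1 not_le)+
      have "x mod 4 = 0 \<or> x mod 4 = 1 \<or> x mod 4 = 2 \<or> x mod 4 = 3" by presburger
      moreover have "(x + 1) mod 4 = (x mod 4 + 1) mod 4" "(x + 2) mod 4 = (x mod 4 + 2) mod 4"
        by presburger+
      ultimately have "f i \<noteq> f (i + 1) \<and> f i \<noteq> f (i + 2)"
        using ab cd unfolding eqs by (elim disjE) auto
      then show ?thesis using 1 by simp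
    next
      case 2
      then have "h = 2" "i = 0 \<or> i = 1" using h by auto
      then show ?thesis using m(2) ab cd by (auto simp: f_def)
    next
      case 3
      then have "i + 2 = m" using m(2) by simp
      then have "(i + 1) mod m = m - 1" "(i + 2) mod m = 0" using m(2) by auto
      then show ?thesis using 3 f0 flast ab cd by auto
    next
      case 4
      then have "(i + 1) mod m = 0" "(i + 2) mod m = 1" using m(2) by (auto simp: mod_if)
      then show ?thesis using 4 f0 flast ab cd by auto
    qed
  qed
  have blocks: "f i \<noteq> f j" if "i < j" "j < m" "(i + h) div 4 = (j + h) div 4" for i j
  proof (cases "i < h")
    case True
    then have "h = 2" "i = 0" "j = 1" using h that by auto
    then show ?thesis using ab by (simp add: f_def)
  next
    case False
    define x y where "x = i - h" and "y = j - h"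
    have ij: "i = x + h" "j = y + h" "x \<noteq> y" using False that by (auto simp: x_def y_def)
    have "x div 4 = y div 4" using that(3) h unfolding ij by auto
    then have "x mod 4 \<noteq> y mod 4" using ij(3) by (metis mult_div_mod_eq)
    moreover have "distinct [c, a, b, d]" using ab cd by auto
    ultimately show ?thesis
      unfolding ij f_def by (simp add: nth_eq_iff_index_eq del: distinct.simps)
  qed
  have "f i \<notin> F" if "i < h" for i
    using that h ab by (cases "i = 0") (auto simp: f_def numeral_2_eq_2 less_Suc_eq)
  then show ?thesis unfolding block_colouring_def using mem cyc blocks L by blast
qed

text \<open>Places are positions shifted by \<open>h\<close>, so that \<open>n = h + m\<close> is a
  multiple of four and the last block consists of the positions \<open>m - 4\<close> to
  \<open>m - 1\<close>. Everything before it is coloured greedily; the unequal lists and a careful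
  choice at position 0 let \<open>distinct_representatives_4\<close> complete the last
  block.\<close>

lemma block_colouring_unequal_lists:
  fixes L :: "nat \<Rightarrow> 'c set"
  assumes m: "even m" "6 \<le> m" "h = m mod 4"
    and F: "finite F" "card F \<le> h"
    and L: "\<And>i. i < m \<Longrightarrow> card (L i) = 4" and neq: "L (m - 3) \<noteq> L (m - 2)"
  shows "\<exists>f. block_colouring m h F L f"
proof -
  have h: "h = 0 \<or> h = 2" using m by presburger
  have fin: "finite (L i)" if "i < m" for i using L[OF that] card.infinite by fastforce
  define n where "n = h + m"
  have n: "n mod 4 = 0" "h + 6 \<le> n" using m h unfolding n_def by presburger+
  \<comment> \<open>If \<open>D\<close> is a single colour and position 0 received it, the two
    middle lists of the last block could shrink to the same three colours. \<open>D'\<close> forbids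
    just this; a larger \<open>D\<close> makes every choice harmless. Together with \<open>F\<close>
    at most three colours are excluded at position 0.\<close>
  define D where "D = L (m - 2) - L (m - 3)"
  define D' where "D' = (if card D = 1 then D else {})"
  have "card D' \<le> 1" "finite D'" using fin[of "m - 2"] m(2) by (auto simp: D_def D'_def)
  then have "card (F \<union> D') < card (L 0)"
    using card_Un_le[of F D'] F h L[of 0] m(2) by auto
  then obtain c0 where c0: "c0 \<in> L 0" "c0 \<notin> F" "c0 \<notin> D'"
    using F(1) \<open>finite D'\<close> card_mono[of "F \<union> D'" "L 0"] by (meson UnCI finite_UnI leD subsetI)
  obtain g0 :: "nat \<Rightarrow> 'c" where g0: "F \<subseteq> g0 ` {..<h}"
    using finite_subset_image_lessThan[of F h] F by auto
  \<comment> \<open>The places below \<open>h\<close> carry all colours of \<open>F\<close>. Place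
    \<open>h\<close> is position 0 of the cycle with its chosen colour, so the greedy part starts at
    \<open>Suc h\<close>.\<close>
  define g where "g = g0(h := c0)"
  define M where "M p = L (p - h)" for p
  have "finite (M p) \<and> card {j. j < p \<and> (p \<le> j + 2 \<or> j div 4 = p div 4)} < card (M p)"
    if "Suc h \<le> p" "p < n - 4" for p
    using that L[of "p - h"] fin[of "p - h"] card_conflicts[of 2 4 p]
    by (auto simp: M_def n_def)
  from greedy_extend[of "Suc h" "n - 4" M "\<lambda>j p. p \<le> j + 2 \<or> j div 4 = p div 4" g, OF this]
  obtain f where f1: "\<forall>p<Suc h. f p = g p"
    and f2: "\<forall>p\<in>{Suc h..<n - 4}. f p \<in> M p \<and>
      (\<forall>j<p. p \<le> j + 2 \<or> j div 4 = p div 4 \<longrightarrow> f j \<noteq> f p)"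
    by blast
  have fh: "f h = c0" using f1 by (simp add: g_def)
  have f_mem: "f p \<in> L (p - h)" if "h \<le> p" "p < n - 4" for p
    using f2 fh c0 that by (cases "p = h") (auto simp: M_def)
  have f_near: "f i \<noteq> f j" if "h \<le> i" "i < j" "j < n - 4" "j \<le> i + 2 \<or> i div 4 = j div 4" for i j
    using f2 that by auto
  \<comment> \<open>The head occupies the places from \<open>h\<close> to \<open>2 * h - 1\<close>,
    which share block 0 with the phantom places because \<open>h \<le> 2\<close>. Place
    \<open>h\<close> itself is covered by the choice of \<open>c0\<close>.\<close>
  have f_head: "f p \<notin> F" if "h \<le> p" "p < 2 * h" for p
  proof
    assume "f p \<in> F"
    then have "p \<noteq> h" using fh c0 by auto
    obtain i where "i < h" "g0 i = f p" using subsetD[OF g0 \<open>f p \<in> F\<close>] by auto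
    then have i: "i < h" "f i = f p" using f1 by (auto simp: g_def)
    have "h \<le> 2" using h by auto
    then have "p < 4" "i < 4" using i(1) that by simp_all
    moreover have "p < n - 4" using \<open>h \<le> 2\<close> that(2) n(2) by linarith
    moreover from calculation have "i div 4 = p div 4" by (simp only: div_less)
    moreover have "Suc h \<le> p" "i < p" using \<open>p \<noteq> h\<close> that i by simp_all
    ultimately show False using bspec[OF f2, of p] i by simp
  qed
  \<comment> \<open>Each of the last four positions loses the colours of the coloured positions at
    cyclic distance at most two: the two before the block, and the positions 0 and 1 after it, which
    are the places \<open>h\<close> and \<open>h + 1\<close>.\<close>
  define A where "A = L (m - 4) - {f (n - 5), f (n - 6)}"
  define B where "B = L (m - 3) - {f (n - 5)}"
  define C where "C = L (m - 2) - {f h}"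
  define E where "E = L (m - 1) - {f h, f (h + 1)}"
  have minus1: "3 \<le> card (L i - {x})" and minus2: "2 \<le> card (L i - {x, y})" if "i < m" for i x y
    using L[OF that] diff_card_le_card_Diff[of "{x}" "L i"] diff_card_le_card_Diff[of "{x, y}" "L i"]
    by (cases "x = y"; simp)+
  have cards: "2 \<le> card A" "3 \<le> card B" "3 \<le> card C" "2 \<le> card E"
    unfolding A_def B_def C_def E_def using m(2) by (intro minus1 minus2; simp)+
  have card_BC: "4 \<le> card (B \<union> C)"
  proof (rule ccontr)
    assume "\<not> 4 \<le> card (B \<union> C)"
    have finBC: "finite B" "finite C" using fin m(2) by (auto simp: B_def C_def)
    \<comment> \<open>With only three colours in the union, \<open>B = C\<close>, and each middle
      list is this set plus its removed colour. As the lists differ, \<open>D\<close> is exactly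
      \<open>{f h}\<close>, so \<open>D'\<close> would contain \<open>c0\<close>.\<close>
    have "card (B \<union> C) \<le> 3" using \<open>\<not> 4 \<le> card (B \<union> C)\<close> by simp
    then have "B = B \<union> C" "C = B \<union> C"
      using cards finBC by (intro card_seteq; auto)+
    then have "B = C" by simp
    have "card B < 4" using \<open>card (B \<union> C) \<le> 3\<close> \<open>B = C\<close> by simp
    have "card C < 4" using \<open>card B < 4\<close> \<open>B = C\<close> by simp
    have "f (n - 5) \<in> L (m - 3)"
      using L[of "m - 3"] m(2) \<open>card B < 4\<close> unfolding B_def by (cases "f (n - 5) \<in> L (m - 3)") simp_all
    moreover have "f h \<in> L (m - 2)"
      using L[of "m - 2"] m(2) \<open>card C < 4\<close> unfolding C_def by (cases "f h \<in> L (m - 2)") simp_all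
    ultimately have eqs: "L (m - 3) = insert (f (n - 5)) B" "L (m - 2) = insert (f h) B"
      using \<open>B = C\<close> unfolding B_def C_def by blast+
    have "f h \<notin> B" using \<open>B = C\<close> by (simp add: C_def)
    then have "D = {f h}" using eqs neq unfolding D_def by auto
    then show False using c0 fh by (simp add: D'_def)
  qed
  obtain a b c e where abce: "a \<in> A" "b \<in> B" "c \<in> C" "e \<in> E" "distinct [a, b, c, e]"
    using distinct_representatives_4[OF cards card_BC] by blast
  define G where "G p = (if p < n - 4 then f p else [a, b, c, e] ! (p - (n - 4)))" for p
  have G_last: "G (n - 4) = a" "G (n - 3) = b" "G (n - 2) = c" "G (n - 1) = e"
    using n(2) by (auto simp: G_def numeral_eq_Suc)
  have G_near: "G i \<noteq> G j" if "h \<le> i" "i < j" "j < n" "j \<le> i + 2 \<or> i div 4 = j div 4" for i j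
  proof -
    consider "j < n - 4" | "n - 4 \<le> i" | "i < n - 4" "n - 4 \<le> j" by linarith
    then show ?thesis
    proof cases
      case 1
      then show ?thesis using f_near that by (simp add: G_def)
    next
      case 2
      then have "i - (n - 4) \<noteq> j - (n - 4)" "i - (n - 4) < 4" "j - (n - 4) < 4" using that by auto
      then show ?thesis
        using 2 that nth_eq_iff_index_eq[OF abce(5), of "i - (n - 4)" "j - (n - 4)"] by (simp add: G_def)
    next
      case 3
      \<comment> \<open>\<open>n - 4\<close> is a block boundary, so a pair across it can only
        conflict by being at distance at most two.\<close>
      obtain t where t: "n - 4 = 4 * t" using n by (metis dvd_diff_nat dvd_def dvd_refl mod_0_imp_dvd)
      have "i div 4 < t" "t \<le> j div 4" using 3 unfolding t by linarith+
      then have "j \<le> i + 2" using that(4) by simp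
      then have "i = n - 5 \<and> j = n - 4 \<or> i = n - 5 \<and> j = n - 3 \<or> i = n - 6 \<and> j = n - 4"
        using 3 by linarith
      then show ?thesis
        using G_last abce n(2) by (elim disjE) (auto simp: A_def B_def G_def)
    qed
  qed
  have G_wrap: "G (n - 1) \<noteq> G h" "G (n - 1) \<noteq> G (h + 1)" "G (n - 2) \<noteq> G h"
    using G_last abce n(2) by (auto simp: C_def E_def G_def)
  define r where "r i = G (i + h)" for i
  have "r i \<in> L i" if "i < m" for i
  proof (cases "i + h < n - 4")
    case True
    then show ?thesis using f_mem[of "i + h"] by (simp add: r_def G_def)
  next
    case False
    then have "i = m - 4 \<or> i = m - 3 \<or> i = m - 2 \<or> i = m - 1"
      using that by (auto simp: n_def)
    moreover have "m - 4 + h = n - 4" "m - 3 + h = n - 3" "m - 2 + h = n - 2" "m - 1 + h = n - 1"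
      using m(2) by (auto simp: n_def)
    moreover have "a \<in> L (m - 4)" "b \<in> L (m - 3)" "c \<in> L (m - 2)" "e \<in> L (m - 1)"
      using abce(1-4) unfolding A_def B_def C_def E_def by blast+
    ultimately show ?thesis
      unfolding r_def using G_last by (elim disjE) simp_all
  qed
  moreover have "r i \<noteq> r ((i + 1) mod m) \<and> r i \<noteq> r ((i + 2) mod m)" if "i < m" for i
  proof -
    consider "i + 2 < m" | "i = m - 2" | "i = m - 1" using \<open>i < m\<close> by linarith
    then show ?thesis
    proof cases
      case 1
      then show ?thesis
        using G_near[of "i + h" "i + 1 + h"] G_near[of "i + h" "i + 2 + h"] by (simp add: r_def n_def)
    next
      case 2
      then have "i + 2 = m" using m(2) by simp
      then have "(i + 1) mod m = i + 1" "(i + 2) mod m = 0" "i + h = n - 2" "i + 1 + h = n - 1"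
        using m(2) by (auto simp: n_def)
      then show ?thesis using G_wrap G_last abce(5) by (auto simp: r_def)
    next
      case 3
      then have "(i + 1) mod m = 0" "(i + 2) mod m = 1" "i + h = n - 1"
        using m(2) by (auto simp: n_def mod_if)
      then show ?thesis using G_wrap by (auto simp: r_def)
    qed
  qed
  moreover have "r i \<noteq> r j" if "i < j" "j < m" "(i + h) div 4 = (j + h) div 4" for i j
    using G_near[of "i + h" "j + h"] that by (simp add: r_def n_def)
  moreover have "r i \<notin> F" if "i < h" for i
    using f_head[of "i + h"] that h n(2) m(2) by (auto simp: r_def G_def n_def)
  ultimately have "block_colouring m h F L r" unfolding block_colouring_def by blast
  then show ?thesis by blast
qed

section \<open>Decomposition of graphs of maximum degree at most two into paths and cycles\<close>

fun links :: "'a list \<Rightarrow> 'a set set" where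
  "links (x # y # zs) = insert {x, y} (links (y # zs))"
| "links _ = {}"

definition clinks :: "'a list \<Rightarrow> 'a set set" where
  "clinks xs = insert {last xs, hd xs} (links xs)"

lemma links_conv_nth: "links xs = {{xs ! i, xs ! Suc i} |i. Suc i < length xs}"
proof (induction xs rule: links.induct)
  case (1 x y zs)
  have "{{(x # y # zs) ! i, (x # y # zs) ! Suc i} |i. Suc i < length (x # y # zs)} =
    insert {x, y} {{(y # zs) ! i, (y # zs) ! Suc i} |i. Suc i < length (y # zs)}"
    (is "?A = insert _ ?B")
  proof
    show "?A \<subseteq> insert {x, y} ?B"
    proof
      fix e assume "e \<in> ?A"
      then obtain i where i: "Suc i < length (x # y # zs)" "e = {(x # y # zs) ! i, (x # y # zs) ! Suc i}"
        by blast
      show "e \<in> insert {x, y} ?B"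
        using i by (cases i) auto
    qed
    show "insert {x, y} ?B \<subseteq> ?A" by (fastforce intro: exI[of _ "0::nat"] exI[of _ "Suc _"])
  qed
  with 1 show ?case by simp
qed auto

lemma links_append:
  "xs \<noteq> [] \<Longrightarrow> ys \<noteq> [] \<Longrightarrow> links (xs @ ys) = insert {last xs, hd ys} (links xs \<union> links ys)"
proof (induction xs rule: links.induct)
  case ("2_2" v)
  then show ?case by (cases ys) auto
qed auto

lemma links_Cons: "xs \<noteq> [] \<Longrightarrow> links (x # xs) = insert {x, hd xs} (links xs)"
  by (cases xs) auto

lemma links_rev [simp]: "links (rev xs) = links xs"
proof (induction xs)
  case (Cons x xs)
  show ?case
  proof (cases "xs = []")
    case False
    then have "links (rev (x # xs)) = insert {hd xs, x} (links xs)"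
      using links_append[of "rev xs" "[x]"] Cons.IH by (simp add: last_rev)
    then show ?thesis using False by (simp add: links_Cons insert_commute)
  qed simp
qed simp

lemma Union_links_subset: "\<Union> (links xs) \<subseteq> set xs"
  by (induction xs rule: links.induct) auto

lemma Union_clinks_subset: "xs \<noteq> [] \<Longrightarrow> \<Union> (clinks xs) \<subseteq> set xs"
  using Union_links_subset[of xs] by (auto simp: clinks_def)

lemma clinks_conv_nth:
  assumes "xs \<noteq> []"
  shows "clinks xs = {{xs ! i, xs ! ((i + 1) mod length xs)} |i. i < length xs}" (is "_ = ?R")
proof
  show "clinks xs \<subseteq> ?R"
  proof
    fix e assume "e \<in> clinks xs"
    then consider "e = {last xs, hd xs}" | i where "Suc i < length xs" "e = {xs ! i, xs ! Suc i}"
      by (auto simp: clinks_def links_conv_nth)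
    then show "e \<in> ?R"
    proof cases
      case 1
      then show ?thesis using assms
        by (intro CollectI exI[of _ "length xs - 1"]) (auto simp: last_conv_nth hd_conv_nth)
    next
      case 2
      then show ?thesis by (intro CollectI exI[of _ i]) auto
    qed
  qed
  show "?R \<subseteq> clinks xs"
  proof
    fix e assume "e \<in> ?R"
    then obtain i where i: "i < length xs" "e = {xs ! i, xs ! ((i + 1) mod length xs)}" by blast
    show "e \<in> clinks xs"
    proof (cases "Suc i < length xs")
      case True
      then show ?thesis using i by (auto simp: clinks_def links_conv_nth)
    next
      case False
      then have "Suc i = length xs" using i by simp
      then have "xs ! i = last xs" "(i + 1) mod length xs = 0"
        using assms by (auto simp: last_conv_nth simp flip: \<open>Suc i = length xs\<close>)
      then show ?thesis using i assms by (simp add: clinks_def hd_conv_nth)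
    qed
  qed
qed

lemma clinks_rotate [simp]: "clinks (rotate n xs) = clinks xs"
proof (induction n)
  case (Suc n)
  have "clinks (rotate1 ys) = clinks ys" for ys :: "'a list"
  proof (cases ys)
    case (Cons y zs)
    show ?thesis
    proof (cases zs)
      case (Cons z zs')
      then have "zs \<noteq> []" by simp
      then show ?thesis
        using links_append[of zs "[y]"] links_Cons[of zs y] \<open>ys = y # zs\<close>
        by (simp add: clinks_def insert_commute)
    qed (use Cons in simp)
  qed simp
  then show ?case using Suc by simp
qed simp

text \<open>An isolated vertex is a path with one entry. Length at least 3 ensures that a vertex on
  a cycle has two different links.\<close>

definition path_cycle_decomp :: "'a set \<Rightarrow> 'a set set \<Rightarrow> 'a list list \<Rightarrow> 'a list list \<Rightarrow> bool" where
  "path_cycle_decomp V E Ps Cs \<longleftrightarrow>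
     distinct (concat Ps @ concat Cs) \<and> V = set (concat Ps) \<union> set (concat Cs) \<and>
     E = \<Union> (links ` set Ps) \<union> \<Union> (clinks ` set Cs) \<and>
     [] \<notin> set Ps \<and> (\<forall>C\<in>set Cs. 3 \<le> length C)"

text \<open>Index arithmetic modulo the length gives a predecessor and a successor, which differ
  because there are at least three vertices.\<close>

lemma two_links_cycle:
  assumes "distinct C" "3 \<le> length C" "x \<in> set C"
  shows "\<exists>A\<in>clinks C. \<exists>B\<in>clinks C. x \<in> A \<and> x \<in> B \<and> A \<noteq> B"
proof -
  obtain i where i: "i < length C" "x = C ! i" using assms(3) by (metis in_set_conv_nth)
  let ?m = "length C"
  define p where "p = (if i = 0 then ?m - 1 else i - 1)"
  define s where "s = (i + 1) mod ?m"
  have "0 < ?m" using i by linarith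
  then have "p < ?m" "s < ?m" "(p + 1) mod ?m = i" using i by (auto simp: p_def s_def)
  moreover have "p \<noteq> s" using i assms(2) by (auto simp: p_def s_def mod_if)
  moreover have "p \<noteq> i" using i assms(2) by (auto simp: p_def)
  moreover have links: "{C ! j, C ! ((j + 1) mod ?m)} \<in> clinks C" if "j < ?m" for j
    using that clinks_conv_nth[of C] by (cases "C = []") auto
  ultimately have "{C ! p, C ! i} \<in> clinks C" "{C ! i, C ! s} \<in> clinks C" "C ! p \<noteq> C ! s" "C ! p \<noteq> C ! i"
    using links[of p] links[of i] i(1) nth_eq_iff_index_eq[OF assms(1)] by (simp_all add: s_def)
  then show ?thesis using i(2) by (intro bexI[of _ "{C ! p, C ! i}"] bexI[of _ "{C ! i, C ! s}"]) (auto simp: doubleton_eq_iff)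
qed

lemma two_links_path:
  assumes "distinct P" "x \<in> set P" "x \<noteq> hd P" "x \<noteq> last P"
  shows "\<exists>A\<in>links P. \<exists>B\<in>links P. x \<in> A \<and> x \<in> B \<and> A \<noteq> B"
proof -
  obtain as bs where P: "P = as @ x # bs" using assms(2) by (metis split_list)
  have ne: "as \<noteq> []" "bs \<noteq> []" using assms(3,4) by (auto simp: P)
  then have "{last as, x} \<in> links P" "{x, hd bs} \<in> links P"
    by (cases bs; auto simp: P links_append)+
  moreover have "last as \<noteq> hd bs" "last as \<noteq> x"
    using assms(1) ne by (cases bs; auto simp: P)+
  ultimately show ?thesis by (intro bexI[of _ "{last as, x}"] bexI[of _ "{x, hd bs}"]) (auto simp: doubleton_eq_iff)
qed

text \<open>Inner vertices of paths and all vertices of cycles lie on two different links, so a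
  vertex on at most one edge can only be an end of a path.\<close>

lemma decomp_endpoint:
  assumes dec: "path_cycle_decomp V E Ps Cs" and "finite E" "x \<in> V" "card {A\<in>E. x \<in> A} \<le> 1"
  shows "\<exists>P\<in>set Ps. x = hd P \<or> x = last P"
proof -
  have unique: "A = B" if "A \<in> E" "B \<in> E" "x \<in> A" "x \<in> B" for A B
    using assms(2,4) that card_le_Suc0_iff_eq[of "{A\<in>E. x \<in> A}"] by auto
  have E: "E = \<Union> (links ` set Ps) \<union> \<Union> (clinks ` set Cs)"
    and dist: "distinct (concat Ps)" "distinct (concat Cs)"
    and len: "\<And>C. C \<in> set Cs \<Longrightarrow> 3 \<le> length C"
    using dec by (auto simp: path_cycle_decomp_def)
  consider P where "P \<in> set Ps" "x \<in> set P" | C where "C \<in> set Cs" "x \<in> set C"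
    using dec assms(3) by (auto simp: path_cycle_decomp_def)
  then show ?thesis
  proof cases
    case 1
    then have "distinct P" using dist by (auto simp: distinct_concat_iff)
    then show ?thesis using two_links_path[of P x] unique 1 unfolding E by blast
  next
    case 2
    then have "distinct C" using dist by (auto simp: distinct_concat_iff)
    then show ?thesis using two_links_cycle[of C x] unique 2 len unfolding E by blast
  qed
qed

text \<open>Order and orientation of the paths do not matter, so joining and closing need only be
  treated at the front of the list.\<close>

lemma decomp_front:
  assumes "path_cycle_decomp V E (As @ P # Bs) Cs"
  shows "path_cycle_decomp V E (P # As @ Bs) Cs" "path_cycle_decomp V E (rev P # As @ Bs) Cs"
  using assms unfolding path_cycle_decomp_def by auto

lemma decomp_last_endpoint:
  assumes dec: "path_cycle_decomp V E Ps Cs" and "finite E" "x \<in> V" "card {A\<in>E. x \<in> A} \<le> 1"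
  shows "\<exists>P Ps'. path_cycle_decomp V E (P # Ps') Cs \<and> last P = x"
proof -
  obtain P where P: "P \<in> set Ps" "x = hd P \<or> x = last P" using decomp_endpoint[OF assms] by blast
  then obtain As Bs where "Ps = As @ P # Bs" by (metis split_list)
  moreover have "P \<noteq> []" using P dec by (auto simp: path_cycle_decomp_def)
  then have "last (rev P) = hd P" by (simp add: last_rev)
  ultimately show ?thesis using decomp_front[of V E As P Bs Cs] dec P by metis
qed

lemma decomp_join:
  assumes "path_cycle_decomp V E (P # Q # Ps) Cs"
  shows "path_cycle_decomp V (insert {last P, hd Q} E) ((P @ Q) # Ps) Cs"
proof -
  have "P \<noteq> []" "Q \<noteq> []" using assms by (auto simp: path_cycle_decomp_def)
  then show ?thesis using assms unfolding path_cycle_decomp_def by (auto simp: links_append)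
qed

lemma decomp_close:
  assumes "path_cycle_decomp V E (P # Ps) Cs" "3 \<le> length P"
  shows "path_cycle_decomp V (insert {last P, hd P} E) Ps (P # Cs)"
  using assms unfolding path_cycle_decomp_def by (auto simp: clinks_def)

text \<open>Both \<open>x\<close> and \<open>y\<close> are path ends before the insertion. If they
  are the two ends of one path, the new edge closes it to a cycle; otherwise it joins two paths
  after suitable reversals.\<close>

lemma decomp_insert:
  assumes dec: "path_cycle_decomp V E Ps Cs" and "finite E" "x \<in> V" "y \<in> V" "x \<noteq> y"
    and deg: "card {A\<in>E. x \<in> A} \<le> 1" "card {A\<in>E. y \<in> A} \<le> 1" and new: "{x, y} \<notin> E"
  shows "\<exists>Ps' Cs'. path_cycle_decomp V (insert {x, y} E) Ps' Cs'"
proof -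
  obtain P Qs where P: "path_cycle_decomp V E (P # Qs) Cs" "last P = x"
    using decomp_last_endpoint[OF dec] assms by blast
  obtain Q where Q: "Q \<in> set (P # Qs)" "y = hd Q \<or> y = last Q"
    using decomp_endpoint[OF P(1)] assms by blast
  show ?thesis
  proof (cases "Q = P")
    case True
    then have y: "y = hd P" using Q P(2) assms by auto
    have "P \<noteq> []" using P(1) by (auto simp: path_cycle_decomp_def)
    \<comment> \<open>A path with one vertex would give \<open>x = y\<close>, and one with two
      vertices would already contain the edge \<open>{x, y}\<close>.\<close>
    have "3 \<le> length P"
    proof (rule ccontr)
      assume "\<not> 3 \<le> length P"
      then have "length P = 1 \<or> length P = 2" using \<open>P \<noteq> []\<close> length_0_conv[of P] by linarith
      then have "P = [y, x]" using y P(2) \<open>x \<noteq> y\<close> by (auto simp: length_Suc_conv numeral_2_eq_2)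
      then show False using P(1) new by (auto simp: path_cycle_decomp_def insert_commute)
    qed
    then show ?thesis using decomp_close[OF P(1)] P(2) y by blast
  next
    case False
    then obtain As Bs where "Qs = As @ Q # Bs" using Q by (metis set_ConsD split_list)
    then have "path_cycle_decomp V E ((P # As) @ Q # Bs) Cs" using P(1) by simp
    from decomp_front[OF this] obtain Q' where
      Q': "path_cycle_decomp V E (Q' # P # As @ Bs) Cs" "hd Q' = y"
      using Q(2) hd_rev[of Q] by auto
    from Q'(1) have "path_cycle_decomp V E (P # Q' # As @ Bs) Cs"
      using decomp_front(1)[of V E "[Q']" P "As @ Bs" Cs] by simp
    from decomp_join[OF this] show ?thesis using Q'(2) P(2) by blast
  qed
qed

text \<open>Induction on the edges, starting from one-vertex paths. The edge about to be inserted
  counts towards the bound 2, so both its ends lie on at most one edge before.\<close>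

lemma path_cycle_decomp_exists:
  assumes "finite V" "finite E" "\<And>A. A \<in> E \<Longrightarrow> A \<subseteq> V \<and> card A = 2"
    and "\<And>v. v \<in> V \<Longrightarrow> card {A\<in>E. v \<in> A} \<le> 2"
  shows "\<exists>Ps Cs. path_cycle_decomp V E Ps Cs"
  using assms(2-4)
proof (induction E rule: finite_induct)
  case empty
  obtain xs where "set xs = V" "distinct xs" using finite_distinct_list[OF assms(1)] by blast
  moreover have "concat (map (\<lambda>x. [x]) xs) = xs" by (induction xs) auto
  ultimately have "path_cycle_decomp V {} (map (\<lambda>x. [x]) xs) []"
    by (auto simp: path_cycle_decomp_def)
  then show ?case by blast
next
  case (insert A E)
  obtain x y where xy: "A = {x, y}" "x \<noteq> y" using insert.prems(1)[of A] by (auto simp: card_2_iff)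
  have "card {B\<in>E. v \<in> B} + of_bool (v \<in> A) \<le> 2" if "v \<in> V" for v
  proof -
    have "{B\<in>insert A E. v \<in> B} = (if v \<in> A then insert A {B\<in>E. v \<in> B} else {B\<in>E. v \<in> B})" by auto
    then show ?thesis using insert.prems(2)[OF that] insert.hyps by (auto split: if_splits)
  qed
  note deg = this
  have "\<exists>Ps Cs. path_cycle_decomp V E Ps Cs"
  proof (rule insert.IH)
    show "card {B\<in>E. v \<in> B} \<le> 2" if "v \<in> V" for v using deg[OF that] by linarith
  qed (use insert.prems in auto)
  then show ?case
    using decomp_insert[of V E _ _ x y] insert.prems(1)[of A] insert.hyps deg[of x] deg[of y] xy
    by fastforce
qed

text \<open>The value of \<open>t\<close> flips along every link, also along the closing one, and
  returns to its start after \<open>length C\<close> steps.\<close>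

lemma even_length_alternating_cycle:
  assumes "C \<noteq> []" "\<And>x y. {x, y} \<in> clinks C \<Longrightarrow> t x \<longleftrightarrow> \<not> t y"
  shows "even (length C)"
proof -
  let ?m = "length C"
  have step: "t (C ! i) \<longleftrightarrow> \<not> t (C ! ((i + 1) mod ?m))" if "i < ?m" for i
    using that clinks_conv_nth[OF assms(1)] by (intro assms(2)) auto
  have "t (C ! i) \<longleftrightarrow> (t (C ! 0) \<longleftrightarrow> even i)" if "i < ?m" for i
    using that
  proof (induction i)
    case (Suc i)
    then show ?case using step[of i] by auto
  qed simp
  from this[of "?m - 1"] step[of "?m - 1"] assms(1) show ?thesis by (cases C) auto
qed

section \<open>Squares of graphs and their bandwidth\<close>

text \<open>This is adjacency in the square of the graph with edge set \<open>E\<close>.\<close>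

definition adj2 :: "'a set set \<Rightarrow> 'a \<Rightarrow> 'a \<Rightarrow> bool" where
  "adj2 E x y \<longleftrightarrow> x \<noteq> y \<and> ({x, y} \<in> E \<or> (\<exists>z. {x, z} \<in> E \<and> {z, y} \<in> E))"

lemma adj2_irrefl [simp]: "\<not> adj2 E x x"
  by (simp add: adj2_def)

lemma adj2_disjoint_Un:
  assumes "adj2 (E1 \<union> E2) x y" "\<Union> E1 \<subseteq> V1" "\<Union> E2 \<subseteq> V2" "V1 \<inter> V2 = {}"
  shows "x \<in> V1 \<and> y \<in> V1 \<and> adj2 E1 x y \<or> x \<in> V2 \<and> y \<in> V2 \<and> adj2 E2 x y"
proof -
  have "{u, w} \<in> E1 \<Longrightarrow> u \<in> V1 \<and> w \<in> V1" "{u, w} \<in> E2 \<Longrightarrow> u \<in> V2 \<and> w \<in> V2" for u w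
    using assms(2,3) by auto
  then show ?thesis using assms(1,4) unfolding adj2_def by blast
qed

lemma banded_mono: "banded d V R \<Longrightarrow> d \<le> d' \<Longrightarrow> banded d' V R"
  unfolding banded_def by (meson add_left_mono le_trans)

text \<open>Entry \<open>i\<close> of the list is put at place \<open>s i\<close>, so that bandwidth
  can be verified by arithmetic on indices.\<close>

lemma banded_nth:
  assumes "distinct xs" and bij: "bij_betw s {..<length xs} {..<length xs}"
    and R: "\<And>i j. i < length xs \<Longrightarrow> j < length xs \<Longrightarrow> R (xs ! i) (xs ! j) \<Longrightarrow>
      s i \<le> s j + d \<and> s j \<le> s i + d"
  shows "banded d (set xs) R"
proof -
  have xs: "bij_betw ((!) xs) {..<length xs} (set xs)"
    using bij_betw_nth[OF assms(1)] by simp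
  define idx where "idx = inv_into {..<length xs} ((!) xs)"
  have "bij_betw (s \<circ> idx) (set xs) {..<card (set xs)}"
    using bij_betw_trans[OF bij_betw_inv_into[OF xs] bij] distinct_card[OF assms(1)]
    by (simp add: idx_def)
  moreover have "idx (xs ! i) = i" if "i < length xs" for i
    using bij_betw_inv_into_left[OF xs] that by (simp add: idx_def)
  ultimately show ?thesis unfolding banded_def
    using R by (intro exI[of _ "s \<circ> idx"]) (auto simp: in_set_conv_nth)
qed

text \<open>The layout of \<open>V2\<close> is appended to that of \<open>V1\<close>. Every edge
  stays inside one part, hence so does adjacency in the square.\<close>

lemma banded_Un:
  assumes V: "finite V1" "finite V2" "V1 \<inter> V2 = {}" "\<Union> E1 \<subseteq> V1" "\<Union> E2 \<subseteq> V2"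
    and band: "banded d V1 (adj2 E1)" "banded d V2 (adj2 E2)"
  shows "banded d (V1 \<union> V2) (adj2 (E1 \<union> E2))"
proof -
  obtain p1 where p1: "bij_betw p1 V1 {..<card V1}"
    "\<forall>x\<in>V1. \<forall>y\<in>V1. adj2 E1 x y \<longrightarrow> p1 x \<le> p1 y + d \<and> p1 y \<le> p1 x + d"
    using band(1) unfolding banded_def by blast
  obtain p2 where p2: "bij_betw p2 V2 {..<card V2}"
    "\<forall>x\<in>V2. \<forall>y\<in>V2. adj2 E2 x y \<longrightarrow> p2 x \<le> p2 y + d \<and> p2 y \<le> p2 x + d"
    using band(2) unfolding banded_def by blast
  define p where "p x = (if x \<in> V1 then p1 x else card V1 + p2 x)" for x
  have "bij_betw p V1 {..<card V1}"
    using p1(1) by (subst bij_betw_cong[of _ _ p1]) (auto simp: p_def)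
  moreover have "bij_betw (\<lambda>i. card V1 + i) {..<card V2} {card V1..<card V1 + card V2}"
    by (rule bij_betw_byWitness[where f' = "\<lambda>i. i - card V1"]) auto
  then have "bij_betw p V2 {card V1..<card V1 + card V2}"
    using bij_betw_trans[OF p2(1), of "\<lambda>i. card V1 + i"] V(3)
    by (subst bij_betw_cong[of _ _ "(\<lambda>i. card V1 + i) \<circ> p2"]) (auto simp: p_def)
  ultimately have "bij_betw p (V1 \<union> V2) ({..<card V1} \<union> {card V1..<card V1 + card V2})"
    by (rule bij_betw_combine) auto
  moreover have "{..<card V1} \<union> {card V1..<card V1 + card V2} = {..<card (V1 \<union> V2)}"
    using V by (auto simp: card_Un_disjoint)
  moreover have "p x \<le> p y + d \<and> p y \<le> p x + d" if "adj2 (E1 \<union> E2) x y" for x y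
    using adj2_disjoint_Un[OF that V(4,5,3)] p1(2) p2(2) V(3) by (auto simp: p_def)
  ultimately show ?thesis unfolding banded_def by auto
qed

lemma banded_Union:
  assumes "distinct (concat xss)" "\<And>xs. xs \<in> set xss \<Longrightarrow> \<Union> (l xs) \<subseteq> set xs"
    "\<And>xs. xs \<in> set xss \<Longrightarrow> banded d (set xs) (adj2 (l xs))"
  shows "banded d (set (concat xss)) (adj2 (\<Union> (l ` set xss)))"
  using assms
proof (induction xss)
  case Nil
  then show ?case by (simp add: banded_def bij_betw_def)
next
  case (Cons xs xss)
  have "banded d (set xs \<union> set (concat xss)) (adj2 (l xs \<union> \<Union> (l ` set xss)))"
  proof (rule banded_Un)
    show "\<Union> (\<Union> (l ` set xss)) \<subseteq> set (concat xss)" using Cons.prems(2) by fastforce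
  qed (use Cons in auto)
  then show ?case by simp
qed

lemma banded_links:
  assumes "distinct xs"
  shows "banded 2 (set xs) (adj2 (links xs))"
proof (rule banded_nth[where s = id])
  fix i j assume ij: "i < length xs" "j < length xs" "adj2 (links xs) (xs ! i) (xs ! j)"
  have near: "b \<le> a + 1 \<and> a \<le> b + 1" if "{xs ! a, xs ! b} \<in> links xs" "a < length xs" "b < length xs" for a b
    using that nth_eq_iff_index_eq[OF assms] by (auto simp: links_conv_nth doubleton_eq_iff)
  show "id i \<le> id j + 2 \<and> id j \<le> id i + 2"
  proof (cases "{xs ! i, xs ! j} \<in> links xs")
    case True
    then show ?thesis using near ij by fastforce
  next
    case False
    then obtain z where z: "{xs ! i, z} \<in> links xs" "{z, xs ! j} \<in> links xs"
      using ij by (auto simp: adj2_def)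
    then have "z \<in> set xs" using Union_links_subset[of xs] by blast
    then obtain k where "k < length xs" "z = xs ! k" by (auto simp: in_set_conv_nth)
    then show ?thesis using near[of i k] near[of k j] z ij by auto
  qed
qed (use assms in auto)

lemma adj2_clinks_nth:
  assumes C: "distinct C" and ij: "i < length C" "j < length C" and adj: "adj2 (clinks C) (C ! i) (C ! j)"
  shows "j = (i + 1) mod length C \<or> j = (i + 2) mod length C \<or>
    i = (j + 1) mod length C \<or> i = (j + 2) mod length C"
proof -
  let ?m = "length C"
  have "C \<noteq> []" using ij by auto
  have near: "b = (a + 1) mod ?m \<or> a = (b + 1) mod ?m" if "{C ! a, C ! b} \<in> clinks C" "a < ?m" "b < ?m" for a b
  proof -
    have "\<exists>k. {C ! a, C ! b} = {C ! k, C ! ((k + 1) mod ?m)} \<and> k < ?m"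
      using that(1) by (simp only: clinks_conv_nth[OF \<open>C \<noteq> []\<close>] mem_Collect_eq)
    then obtain k where k: "k < ?m" "{C ! a, C ! b} = {C ! k, C ! ((k + 1) mod ?m)}"
      by (elim exE conjE)
    moreover have "(k + 1) mod ?m < ?m" using k(1) by (intro mod_less_divisor) linarith
    ultimately have "a = k \<and> b = (k + 1) mod ?m \<or> a = (k + 1) mod ?m \<and> b = k"
      using that(2,3) nth_eq_iff_index_eq[OF C] unfolding doubleton_eq_iff by metis
    then show ?thesis by metis
  qed
  have inj: "a = b" if "(a + 1) mod ?m = (b + 1) mod ?m" "a < ?m" "b < ?m" for a b
    using that by (auto simp: mod_Suc split: if_splits)
  show ?thesis
  proof (cases "{C ! i, C ! j} \<in> clinks C")
    case True
    then show ?thesis using near ij by blast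
  next
    case False
    then obtain z where z: "{C ! i, z} \<in> clinks C" "{z, C ! j} \<in> clinks C"
      using adj by (auto simp: adj2_def)
    then have "z \<in> set C" using Union_clinks_subset[OF \<open>C \<noteq> []\<close>] by blast
    then obtain k where k: "k < ?m" "z = C ! k" by (auto simp: in_set_conv_nth)
    have "i \<noteq> j" using adj by auto
    have *: "((a + 1) mod ?m + 1) mod ?m = (a + 2) mod ?m" for a by (simp add: mod_simps)
    \<comment> \<open>If the common neighbour \<open>k\<close> were the successor of both or the
      predecessor of both, then \<open>i = j\<close>; so \<open>i\<close>, \<open>k\<close>,
      \<open>j\<close> are consecutive in one of the two directions.\<close>
    have "k = (i + 1) mod ?m \<or> i = (k + 1) mod ?m" "j = (k + 1) mod ?m \<or> k = (j + 1) mod ?m"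
      using near z ij k by blast+
    then show ?thesis using * inj[OF _ ij] \<open>i \<noteq> j\<close> by metis
  qed
qed

text \<open>Folding the cycle: the order is \<open>0, m - 1, 1, m - 2, \<dots>\<close>\<close>

lemma banded_clinks:
  assumes "distinct C" "even (length C)" "C \<noteq> []"
  shows "banded 4 (set C) (adj2 (clinks C))"
proof -
  let ?m = "length C"
  define s where "s i = (if 2 * i < ?m then 2 * i else 2 * (?m - 1 - i) + 1)" for i
  have "inj_on s {..<?m}" unfolding s_def by (rule inj_onI) (auto split: if_splits, presburger+)
  moreover have "s ` {..<?m} \<subseteq> {..<?m}" using assms(2) by (auto simp: s_def)
  ultimately have bij: "bij_betw s {..<?m} {..<?m}" by (simp add: bij_betw_def endo_inj_surj)
  \<comment> \<open>Cyclic neighbours are at most two places apart in the folded order, also at both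
    folds; adjacency in the square takes at most two such steps, hence four places.\<close>
  have step: "s ((i + 1) mod ?m) \<le> s i + 2 \<and> s i \<le> s ((i + 1) mod ?m) + 2" if "i < ?m" for i
  proof (cases "i + 1 < ?m")
    case True
    then show ?thesis using assms(2) by (auto simp: s_def)
  next
    case False
    then have "i + 1 = ?m" using that by simp
    then have "(i + 1) mod ?m = 0" by simp
    then show ?thesis using \<open>i + 1 = ?m\<close> by (auto simp: s_def)
  qed
  have step2: "s ((i + 2) mod ?m) \<le> s i + 4 \<and> s i \<le> s ((i + 2) mod ?m) + 4" if "i < ?m" for i
  proof -
    have "((i + 1) mod ?m + 1) mod ?m = (i + 2) mod ?m" by (simp add: mod_simps)
    moreover have "(i + 1) mod ?m < ?m" using that by (intro mod_less_divisor) linarith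
    ultimately show ?thesis using step[OF that] step[of "(i + 1) mod ?m"] by simp
  qed
  show ?thesis
  proof (rule banded_nth[OF assms(1) bij])
    fix i j assume "i < ?m" "j < ?m" "adj2 (clinks C) (C ! i) (C ! j)"
    then show "s i \<le> s j + 4 \<and> s j \<le> s i + 4"
      using adj2_clinks_nth[OF assms(1), of i j] step[of i] step[of j] step2[of i] step2[of j] by auto
  qed
qed

section \<open>Combining colourings of several cycles when k = 4\<close>

text \<open>The colours in \<open>R\<close> may exceed the quota \<open>card V div 4\<close> by one,
  and there are no more of them than the remainder. Recording which colours are in excess lets
  further components avoid them, which a bare bound by the ceiling would not allow.\<close>

definition quota_colouring ::
  "'a set \<Rightarrow> 'a set set \<Rightarrow> ('a \<Rightarrow> 'c set) \<Rightarrow> ('a \<Rightarrow> 'c) \<Rightarrow> 'c set \<Rightarrow> bool" where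
  "quota_colouring V E L f R \<longleftrightarrow>
     (\<forall>v\<in>V. f v \<in> L v) \<and> (\<forall>x\<in>V. \<forall>y\<in>V. adj2 E x y \<longrightarrow> f x \<noteq> f y) \<and>
     finite R \<and> card R \<le> card V mod 4 \<and>
     (\<forall>c. card {v\<in>V. f v = c} \<le> card V div 4 + of_bool (c \<in> R))"

text \<open>The colours of the head serve as the excess set \<open>R\<close>.\<close>

lemma quota_colouring_of_block_colouring:
  assumes C: "distinct C" "even (length C)"
    and g: "block_colouring (length C) (length C mod 4) F (\<lambda>i. L (C ! i)) g"
  shows "\<exists>f R. quota_colouring (set C) (clinks C) L f R \<and> R \<inter> F = {}"
proof -
  let ?m = "length C"
  have bij: "bij_betw ((!) C) {..<?m} (set C)" using bij_betw_nth[OF C(1)] by simp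
  define f where "f v = g (inv_into {..<?m} ((!) C) v)" for v
  have f: "f (C ! i) = g i" if "i < ?m" for i
    using bij_betw_inv_into_left[OF bij] that by (simp add: f_def)
  have "bij_betw ((!) C) {i\<in>{..<?m}. g i = c} {v\<in>set C. f v = c}" for c
    by (rule bij_betw_subset[OF bij]) (auto simp: f in_set_conv_nth)
  then have count: "card {v\<in>set C. f v = c} = card {i\<in>{..<?m}. g i = c}" for c
    by (metis bij_betw_same_card)
  have g': "g i \<in> L (C ! i) \<and> g i \<noteq> g ((i + 1) mod ?m) \<and> g i \<noteq> g ((i + 2) mod ?m)" if "i < ?m" for i
    using g that by (auto simp: block_colouring_def)
  have "f x \<noteq> f y" if xy: "x \<in> set C" "y \<in> set C" "adj2 (clinks C) x y" for x y
  proof -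
    obtain i j where "i < ?m" "x = C ! i" "j < ?m" "y = C ! j"
      using xy(1,2) by (auto simp: in_set_conv_nth)
    then show ?thesis
      using adj2_clinks_nth[OF C(1), of i j] xy(3) f g'[of i] g'[of j] by metis
  qed
  moreover have "f v \<in> L v" if "v \<in> set C" for v
    using that f g' by (auto simp: in_set_conv_nth)
  moreover note block_colouring_count[OF g refl C(2)]
  ultimately have "quota_colouring (set C) (clinks C) L f (g ` {..<?m mod 4})"
    using count distinct_card[OF C(1)] unfolding quota_colouring_def by auto
  then show ?thesis using block_colouring_count(3)[OF g refl C(2)] by blast
qed

lemma quota_colouring_cycle:
  fixes L :: "'a \<Rightarrow> 'c set"
  assumes C: "distinct C" "even (length C)" "4 \<le> length C"
    and L: "\<And>v. v \<in> set C \<Longrightarrow> finite (L v) \<and> card (L v) = 4"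
    and F: "finite F" "card F \<le> length C mod 4"
  shows "\<exists>f R. quota_colouring (set C) (clinks C) L f R \<and> R \<inter> F = {}"
proof (cases "length C = 4")
  case True
  then have "card (set C) = 4" using distinct_card[OF C(1)] by simp
  \<comment> \<open>Four vertices form a single block in any order, so the greedy colouring uses
    four different colours and nothing is in excess.\<close>
  have "banded 3 (set C) (adj2 (clinks C))"
    by (rule banded_nth[OF C(1), of id]) (use True in auto)
  from greedy_banded[OF _ this, of 4 L "{}" 0] L obtain f where
    f: "\<forall>v\<in>set C. f v \<in> L v" "\<forall>x\<in>set C. \<forall>y\<in>set C. adj2 (clinks C) x y \<longrightarrow> f x \<noteq> f y"
    and count: "\<forall>c. card {v\<in>set C. f v = c} + of_bool (c \<in> {}) \<le> (0 + card (set C) + 4 - 1) div 4"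
    by auto
  have "quota_colouring (set C) (clinks C) L f {}"
    using f count \<open>card (set C) = 4\<close> by (simp add: quota_colouring_def)
  then show ?thesis by blast
next
  case False
  then have len: "6 \<le> length C" using C by presburger
  show ?thesis
  proof (cases "\<forall>i. Suc i < length C \<longrightarrow> L (C ! i) = L (C ! Suc i)")
    case True
    have "L (C ! i) = L (C ! 0)" if "i < length C" for i
      using that by (induction i) (use True in auto)
    moreover have "card (L (C ! 0)) = 4" using L len by (intro conjunct2[OF L]) (auto intro: nth_mem)
    ultimately obtain g where "block_colouring (length C) (length C mod 4) F (\<lambda>i. L (C ! i)) g"
      using block_colouring_equal_lists[of "length C" "length C mod 4" "L (C ! 0)" F "\<lambda>i. L (C ! i)"]
        C(2) len F by blast
    then show ?thesis using quota_colouring_of_block_colouring C by blast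
  next
    case False
    then obtain p where p: "Suc p < length C" "L (C ! p) \<noteq> L (C ! Suc p)" by blast
    \<comment> \<open>Rotation by \<open>p + 3\<close> moves the old entries \<open>p\<close> and
      \<open>Suc p\<close> to the indices \<open>length C - 3\<close> and
      \<open>length C - 2\<close>, where \<open>block_colouring_unequal_lists\<close> wants the
      difference.\<close>
    define D where "D = rotate (p + 3) C"
    have D: "distinct D" "length D = length C" "set D = set C" "clinks D = clinks C"
      using C(1) by (simp_all add: D_def)
    have "p + 3 + (length C - 3) = p + length C" "p + 3 + (length C - 2) = Suc p + length C"
      using len by simp_all
    then have "(p + 3 + (length C - 3)) mod length C = p" "(p + 3 + (length C - 2)) mod length C = Suc p"
      using p(1) by (simp_all only: mod_add_self2 mod_less Suc_lessD)
    then have "D ! (length C - 3) = C ! p" "D ! (length C - 2) = C ! Suc p"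
      using len by (simp_all add: D_def nth_rotate)
    then have "L (D ! (length D - 3)) \<noteq> L (D ! (length D - 2))" using p(2) D(2) by simp
    moreover have "card (L (D ! i)) = 4" if "i < length D" for i
      using that L D(3) nth_mem[of i D] by blast
    ultimately obtain g where "block_colouring (length D) (length D mod 4) F (\<lambda>i. L (D ! i)) g"
      using block_colouring_unequal_lists[of "length D" "length D mod 4" F "\<lambda>i. L (D ! i)"]
        C(2) len F D(2) by metis
    then show ?thesis using quota_colouring_of_block_colouring[of D F L g] D C(2) by metis
  qed
qed

lemma card_colour_class_Un:
  assumes "finite V1" "finite V2" "V1 \<inter> V2 = {}"
  shows "card {v \<in> V1 \<union> V2. (if v \<in> V1 then f1 v else f2 v) = c} =
    card {v\<in>V1. f1 v = c} + card {v\<in>V2. f2 v = c}"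
proof -
  have eq: "{v \<in> V1 \<union> V2. (if v \<in> V1 then f1 v else f2 v) = c} = {v\<in>V1. f1 v = c} \<union> {v\<in>V2. f2 v = c}"
    using assms(3) by auto
  then show ?thesis using assms unfolding eq by (intro card_Un_disjoint) auto
qed

lemma proper_Un:
  assumes "\<Union> E1 \<subseteq> V1" "\<Union> E2 \<subseteq> V2" "V1 \<inter> V2 = {}"
    and "\<forall>x\<in>V1. \<forall>y\<in>V1. adj2 E1 x y \<longrightarrow> f1 x \<noteq> f1 y" "\<forall>x\<in>V2. \<forall>y\<in>V2. adj2 E2 x y \<longrightarrow> f2 x \<noteq> f2 y"
    and "adj2 (E1 \<union> E2) x y"
  shows "(if x \<in> V1 then f1 x else f2 x) \<noteq> (if y \<in> V1 then f1 y else f2 y)"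
  using adj2_disjoint_Un[OF assms(6,1,2,3)]
proof (elim disjE conjE)
  assume "x \<in> V1" "y \<in> V1" "adj2 E1 x y"
  then show ?thesis using assms(4) by simp
next
  assume xy: "x \<in> V2" "y \<in> V2" "adj2 E2 x y"
  then have "x \<notin> V1" "y \<notin> V1" using assms(3) by blast+
  then show ?thesis using assms(5) xy by simp
qed

text \<open>All cycle lengths are 0 or 2 modulo 4. A cycle of remainder 2 is made to avoid the
  current excess colours: two remainders of 2 make one further unit of quota, and with disjoint
  excess sets no colour needs more than that unit.\<close>

lemma quota_colouring_cycles:
  fixes L :: "'a \<Rightarrow> 'c set"
  assumes "distinct (concat Cs)" "\<And>C. C \<in> set Cs \<Longrightarrow> even (length C) \<and> 4 \<le> length C"
    and L: "\<And>v. v \<in> set (concat Cs) \<Longrightarrow> finite (L v) \<and> card (L v) = 4"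
  shows "even (card (set (concat Cs))) \<and>
    (\<exists>f R. quota_colouring (set (concat Cs)) (\<Union> (clinks ` set Cs)) L f R)"
  using assms
proof (induction Cs)
  case Nil
  then show ?case by (auto simp: quota_colouring_def)
next
  case (Cons C Cs)
  define V1 where "V1 = set (concat Cs)"
  define V2 where "V2 = set C"
  define E1 where "E1 = \<Union> (clinks ` set Cs)"
  have "even (card V1) \<and> (\<exists>f R. quota_colouring V1 E1 L f R)"
    unfolding V1_def E1_def using Cons.prems by (intro Cons.IH) auto
  then obtain f1 R1 where even1: "even (card V1)" and q1: "quota_colouring V1 E1 L f1 R1" by blast
  have C: "distinct C" "even (length C)" "4 \<le> length C" and card2: "card V2 = length C"
    using Cons.prems by (auto simp: V2_def distinct_card)
  have disj: "V1 \<inter> V2 = {}" and fin: "finite V1" "finite V2"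
    using Cons.prems(1) by (auto simp: V1_def V2_def)
  \<comment> \<open>A cycle of length divisible by four has no head and no excess of its own, so
    nothing is forbidden on it.\<close>
  define F where "F = (if length C mod 4 = 0 then {} else R1)"
  have R1: "finite R1" "card R1 \<le> card V1 mod 4" using q1 by (auto simp: quota_colouring_def)
  have even_mod_4: "n mod 4 = 0 \<or> n mod 4 = 2" if "even n" for n :: nat using that by presburger
  note cases = even_mod_4[OF even1] even_mod_4[OF C(2)]
  have "card R1 \<le> 2" using R1(2) cases(1) by (elim disjE) simp_all
  then have "finite F" "card F \<le> length C mod 4" using R1(1) cases(2) by (auto simp: F_def)
  then obtain f2 R2 where q2: "quota_colouring V2 (clinks C) L f2 R2" and R2: "R2 \<inter> F = {}"
    using quota_colouring_cycle[OF C, of L F] Cons.prems(3) by (auto simp: V2_def)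
  define f where "f v = (if v \<in> V1 then f1 v else f2 v)" for v
  \<comment> \<open>When both remainders are 2, the extra unit of quota absorbs the excess.
    Otherwise one of \<open>R1\<close> and \<open>R2\<close> is empty and the other carries
    over.\<close>
  define R where "R = (if card V1 mod 4 = 2 \<and> length C mod 4 = 2 then {} else R1 \<union> R2)"
  have cardV: "card (V1 \<union> V2) = card V1 + length C" using fin disj card2 by (simp add: card_Un_disjoint)
  have R2f: "finite R2" "card R2 \<le> length C mod 4" using q2 card2 by (auto simp: quota_colouring_def)
  have R: "finite R" "card R \<le> card (V1 \<union> V2) mod 4"
    "card V1 div 4 + of_bool (c \<in> R1) + (length C div 4 + of_bool (c \<in> R2))
      \<le> card (V1 \<union> V2) div 4 + of_bool (c \<in> R)" for c
  proof -
    show "finite R" using R1 R2f by (simp add: R_def)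
    have sum: "card (V1 \<union> V2) div 4 = card V1 div 4 + length C div 4 + (card V1 mod 4 + length C mod 4) div 4"
      "card (V1 \<union> V2) mod 4 = (card V1 mod 4 + length C mod 4) mod 4"
      unfolding cardV by (rule div_add1_eq) (simp add: mod_add_eq)
    consider "card V1 mod 4 = 2" "length C mod 4 = 2" "R = {}" "R2 \<inter> R1 = {}"
      | "length C mod 4 = 0" "R2 = {}" "R = R1" | "card V1 mod 4 = 0" "R1 = {}" "R = R2"
      using cases R1 R2f R2 by (auto simp: R_def F_def)
    then have "card R \<le> card (V1 \<union> V2) mod 4 \<and>
      card V1 div 4 + of_bool (c \<in> R1) + (length C div 4 + of_bool (c \<in> R2))
        \<le> card (V1 \<union> V2) div 4 + of_bool (c \<in> R)"
    proof cases
      case 1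
      then have "c \<notin> R1 \<or> c \<notin> R2" by blast
      then show ?thesis unfolding sum 1 by (elim disjE) simp_all
    next
      case 2
      then show ?thesis unfolding sum 2 using R1(2) by simp
    next
      case 3
      then show ?thesis unfolding sum 3 using R2f(2) by simp
    qed
    then show "card R \<le> card (V1 \<union> V2) mod 4"
      "card V1 div 4 + of_bool (c \<in> R1) + (length C div 4 + of_bool (c \<in> R2))
        \<le> card (V1 \<union> V2) div 4 + of_bool (c \<in> R)"
      by blast+
  qed
  have lists: "\<forall>v\<in>V1. f1 v \<in> L v" "\<forall>v\<in>V2. f2 v \<in> L v"
    and proper: "\<forall>x\<in>V1. \<forall>y\<in>V1. adj2 E1 x y \<longrightarrow> f1 x \<noteq> f1 y"
      "\<forall>x\<in>V2. \<forall>y\<in>V2. adj2 (clinks C) x y \<longrightarrow> f2 x \<noteq> f2 y"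
    using q1 q2 unfolding quota_colouring_def by blast+
  have "quota_colouring (V1 \<union> V2) (E1 \<union> clinks C) L f R"
    unfolding quota_colouring_def
  proof (intro conjI ballI allI impI)
    fix c
    have "card {v \<in> V1 \<union> V2. f v = c} = card {v\<in>V1. f1 v = c} + card {v\<in>V2. f2 v = c}"
      unfolding f_def by (rule card_colour_class_Un[OF fin disj])
    also have "\<dots> \<le> card V1 div 4 + of_bool (c \<in> R1) + (length C div 4 + of_bool (c \<in> R2))"
      using q1 q2 card2 by (intro add_mono) (auto simp: quota_colouring_def)
    also have "\<dots> \<le> card (V1 \<union> V2) div 4 + of_bool (c \<in> R)" by (rule R(3))
    finally show "card {v \<in> V1 \<union> V2. f v = c} \<le> card (V1 \<union> V2) div 4 + of_bool (c \<in> R)" .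
  next
    fix x y assume xy: "adj2 (E1 \<union> clinks C) x y"
    have sub: "\<Union> (clinks D) \<subseteq> set D" if "D \<in> set (C # Cs)" for D
      using Cons.prems(2)[OF that] by (intro Union_clinks_subset) auto
    have "\<Union> E1 \<subseteq> V1" unfolding E1_def V1_def using sub by (simp add: UN_subset_iff Sup_le_iff) blast
    moreover have "\<Union> (clinks C) \<subseteq> V2" unfolding V2_def by (rule sub) simp
    ultimately show "f x \<noteq> f y"
      unfolding f_def using proper_Un[OF _ _ disj proper xy] by simp
  next
    fix v assume "v \<in> V1 \<union> V2"
    then show "f v \<in> L v" using lists by (cases "v \<in> V1") (simp_all add: f_def)
  qed (rule R)+
  moreover have "even (card (V1 \<union> V2))" using cardV even1 C(2) by simp
  ultimately show ?case by (auto simp: V1_def V2_def E1_def Un_commute)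
qed

section \<open>Equitable colouring of the square of a union of paths and even cycles\<close>

text \<open>Greedy colouring in blocks of \<open>k\<close> works when the bandwidth is below
  \<open>k\<close>; it is 0 without edges, at most 2 for paths and at most 4 with even cycles. For
  \<open>k = 4\<close> the cycles are coloured first by \<open>quota_colouring_cycles\<close>, and
  the paths then absorb their excess.\<close>

lemma equitable_square_colouring:
  fixes L :: "'a \<Rightarrow> 'c set"
  assumes dec: "path_cycle_decomp V E Ps Cs" and evenC: "\<And>C. C \<in> set Cs \<Longrightarrow> even (length C)"
    and L: "\<And>v. v \<in> V \<Longrightarrow> finite (L v) \<and> card (L v) = k"
    and k: "4 \<le> k \<or> (3 \<le> k \<and> Cs = []) \<or> (1 \<le> k \<and> E = {})"
  shows "\<exists>f. (\<forall>v\<in>V. f v \<in> L v) \<and> (\<forall>x\<in>V. \<forall>y\<in>V. adj2 E x y \<longrightarrow> f x \<noteq> f y) \<and>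
    (\<forall>c. card {v\<in>V. f v = c} \<le> (card V + k - 1) div k)"
proof -
  define V1 where "V1 = set (concat Cs)"
  define V2 where "V2 = set (concat Ps)"
  define E1 where "E1 = \<Union> (clinks ` set Cs)"
  define E2 where "E2 = \<Union> (links ` set Ps)"
  have V: "V = V1 \<union> V2" "V1 \<inter> V2 = {}" "finite V1" "finite V2" and E: "E = E1 \<union> E2"
    and dist: "distinct (concat Cs)" "distinct (concat Ps)"
    and len: "\<And>C. C \<in> set Cs \<Longrightarrow> 3 \<le> length C"
    using dec by (auto simp: path_cycle_decomp_def V1_def V2_def E1_def E2_def)
  have Cs: "C \<noteq> []" "distinct C" "even (length C)" "4 \<le> length C" if "C \<in> set Cs" for C
  proof -
    show "C \<noteq> []" "distinct C" "even (length C)"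
      using that len[OF that] dist(1) evenC by (auto simp: distinct_concat_iff)
    then show "4 \<le> length C" using len[OF that] by presburger
  qed
  have subC: "\<Union> (clinks C) \<subseteq> set C" if "C \<in> set Cs" for C
    using Cs(1)[OF that] by (rule Union_clinks_subset)
  have sub: "\<Union> E1 \<subseteq> V1" "\<Union> E2 \<subseteq> V2"
  proof -
    have "A \<subseteq> set C" if "C \<in> set Cs" "A \<in> clinks C" for A C using subC[OF that(1)] that(2) by blast
    then show "\<Union> E1 \<subseteq> V1" by (fastforce simp: E1_def V1_def)
    have "A \<subseteq> set P" if "A \<in> links P" for A and P :: "'a list"
      using Union_links_subset[of P] that by blast
    then show "\<Union> E2 \<subseteq> V2" by (fastforce simp: E2_def V2_def)
  qed
  have band2: "banded 2 V2 (adj2 E2)"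
    unfolding V2_def E2_def
  proof (rule banded_Union[OF dist(2)])
    show "banded 2 (set P) (adj2 (links P))" if "P \<in> set Ps" for P
      using that dist(2) by (intro banded_links) (simp add: distinct_concat_iff)
  qed (rule Union_links_subset)
  have by_band: ?thesis if "banded d V (adj2 E)" "d < k" for d
  proof -
    have "finite V" using V by simp
    then show ?thesis
      using greedy_banded[of V d "adj2 E" k L "{}" 0] that L by (simp del: card_eq_0_iff)
  qed
  consider "E = {}" "1 \<le> k" | "Cs = []" "3 \<le> k" | "k = 4" | "5 \<le> k" using k by linarith
  then show ?thesis
  proof cases
    case 1
    have "\<exists>p. bij_betw p V {..<card V}"
      using V(1,3,4) ex_bij_betw_finite_nat[of V] by (simp add: atLeast0LessThan)
    then have "banded 0 V (adj2 E)" by (auto simp: banded_def adj2_def 1)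
    then show ?thesis using by_band 1 by simp
  next
    case 2
    then show ?thesis using by_band[of 2] band2 V(1) E by (simp add: V1_def E1_def)
  next
    case 4
    have "banded 4 V1 (adj2 E1)"
      unfolding V1_def E1_def using subC Cs by (intro banded_Union[OF dist(1)] banded_clinks)
    then have "banded 4 V (adj2 E)"
      unfolding V E using V sub banded_mono[OF band2, of 4] by (intro banded_Un) auto
    then show ?thesis using by_band[of 4] 4 by simp
  next
    case 3
    have "\<exists>f R. quota_colouring V1 E1 L f R"
      unfolding V1_def E1_def using quota_colouring_cycles[OF dist(1), of L] Cs L 3 V(1) by (auto simp: V1_def)
    then obtain f1 R where f1: "\<forall>v\<in>V1. f1 v \<in> L v" "\<forall>x\<in>V1. \<forall>y\<in>V1. adj2 E1 x y \<longrightarrow> f1 x \<noteq> f1 y"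
      "finite R" "card R \<le> card V1 mod 4" "\<forall>c. card {v\<in>V1. f1 v = c} \<le> card V1 div 4 + of_bool (c \<in> R)"
      unfolding quota_colouring_def by blast
    \<comment> \<open>The cycles account for \<open>card V1 div 4\<close> full blocks and
      \<open>card V1 mod 4\<close> places of a further one. The paths continue in that block, with
      the excess colours \<open>R\<close> on its phantom places.\<close>
    have "\<exists>f2. (\<forall>v\<in>V2. f2 v \<in> L v) \<and> (\<forall>x\<in>V2. \<forall>y\<in>V2. adj2 E2 x y \<longrightarrow> f2 x \<noteq> f2 y) \<and>
      (\<forall>c. card {v\<in>V2. f2 v = c} + of_bool (c \<in> R) \<le> (card V1 mod 4 + card V2 + 4 - 1) div 4)"
      using L V(1) 3 f1(3,4) by (intro greedy_banded[OF V(4) band2]) auto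
    then obtain f2 where f2: "\<forall>v\<in>V2. f2 v \<in> L v" "\<forall>x\<in>V2. \<forall>y\<in>V2. adj2 E2 x y \<longrightarrow> f2 x \<noteq> f2 y"
      "\<forall>c. card {v\<in>V2. f2 v = c} + of_bool (c \<in> R) \<le> (card V1 mod 4 + card V2 + 4 - 1) div 4"
      by blast
    define f where "f v = (if v \<in> V1 then f1 v else f2 v)" for v
    have "f v \<in> L v" if "v \<in> V" for v
      using that f1(1) f2(1) V(1) by (cases "v \<in> V1") (simp_all add: f_def)
    moreover have "f x \<noteq> f y" if "adj2 E x y" for x y
      using proper_Un[OF sub V(2) f1(2) f2(2)] that unfolding E f_def by blast
    moreover have "card {v\<in>V. f v = c} \<le> (card V + k - 1) div k" for c
    proof -
      have "card {v\<in>V. f v = c} = card {v\<in>V1. f1 v = c} + card {v\<in>V2. f2 v = c}"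
        unfolding f_def V(1) by (rule card_colour_class_Un[OF V(3,4,2)])
      also have "\<dots> \<le> card V1 div 4 + of_bool (c \<in> R) + card {v\<in>V2. f2 v = c}"
        using f1(5) by (intro add_right_mono) blast
      also have "\<dots> = card V1 div 4 + (card {v\<in>V2. f2 v = c} + of_bool (c \<in> R))" by simp
      also have "\<dots> \<le> card V1 div 4 + (card V1 mod 4 + card V2 + 4 - 1) div 4"
        using f2(3) by (intro add_left_mono) blast
      \<comment> \<open>The full blocks are moved under the rounding, which merges both counts into
        a single ceiling.\<close>
      also have "\<dots> = (card V1 mod 4 + card V2 + 4 - 1 + card V1 div 4 * 4) div 4"
        by (simp only: div_mult_self1 zero_neq_numeral not_False_eq_True)
      also have "card V1 mod 4 + card V2 + 4 - 1 + card V1 div 4 * 4 = card V1 + card V2 + 4 - 1"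
        using div_mult_mod_eq[of "card V1" 4] by linarith
      also have "\<dots> div 4 = (card V + k - 1) div k"
        using V 3 by (simp only: card_Un_disjoint)
      finally show ?thesis .
    qed
    ultimately show ?thesis by blast
  qed
qed

section \<open>Total graphs as squares of subdivisions\<close>

text \<open>Each edge \<open>e\<close> of \<open>G\<close> becomes a middle vertex
  \<open>Inr e\<close>. Parallel edges get different middle vertices, so the subdivision of a
  multigraph is simple and a set of two-element sets suffices.\<close>

definition subdivision_edges :: "('v, 'e) mgraph \<Rightarrow> ('v + 'e) set set" where
  "subdivision_edges G = {{Inl v, Inr e} |v e. e \<in> medges G \<and> v \<in> ends G e}"

lemma subdivision_edges_iff [simp]:
  "{Inl v, Inr e} \<in> subdivision_edges G \<longleftrightarrow> e \<in> medges G \<and> v \<in> ends G e"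
  "{Inr e, Inl v} \<in> subdivision_edges G \<longleftrightarrow> e \<in> medges G \<and> v \<in> ends G e"
  by (auto simp: subdivision_edges_def doubleton_eq_iff)

text \<open>Two adjacent vertices meet in the middle vertex of a joining edge, two adjacent edges in
  a shared endpoint, and an incidence is itself an edge of the subdivision. Thus a proper colouring
  of the square is proper on the total graph.\<close>

lemma total_adj_imp_adj2:
  assumes "x \<in> mverts G <+> medges G" "y \<in> mverts G <+> medges G" "total_adj G x y"
  shows "adj2 (subdivision_edges G) x y"
proof (cases x; cases y)
  fix u v assume xy: "x = Inl u" "y = Inl v"
  then obtain e where "e \<in> medges G" "ends G e = {u, v}" "u \<noteq> v" using assms(3) by auto
  then show ?thesis using xy by (auto simp: adj2_def intro!: exI[of _ "Inr e"])
next
  fix e f assume xy: "x = Inr e" "y = Inr f"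
  then obtain w where "w \<in> ends G e" "w \<in> ends G f" "e \<noteq> f" using assms(3) by auto
  then show ?thesis using xy assms(1,2) by (auto simp: adj2_def intro!: exI[of _ "Inl w"])
qed (use assms in \<open>auto simp: adj2_def\<close>)

lemma degree_le_max_degree:
  assumes "multigraph G" "v \<in> mverts G"
  shows "degree G v \<le> max_degree G"
  using assms unfolding max_degree_def multigraph_def by (intro Max_ge) auto

lemma subdivision_degree_Inl:
  assumes "multigraph G"
  shows "card {A \<in> subdivision_edges G. Inl v \<in> A} \<le> degree G v"
proof -
  have "{A \<in> subdivision_edges G. Inl v \<in> A} \<subseteq> (\<lambda>e. {Inl v, Inr e}) ` {e \<in> medges G. v \<in> ends G e}"
    by (auto simp: subdivision_edges_def)
  then show ?thesis
    using assms unfolding degree_def multigraph_def by (intro surj_card_le) auto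
qed

lemma subdivision_degree_Inr:
  assumes "multigraph G"
  shows "card {A \<in> subdivision_edges G. Inr e \<in> A} \<le> 2"
proof (cases "e \<in> medges G")
  case True
  then have two: "card (ends G e) = 2" using assms by (simp add: multigraph_def)
  then have fin: "finite (ends G e)" by (intro card_ge_0_finite) simp
  have sub: "{A \<in> subdivision_edges G. Inr e \<in> A} \<subseteq> (\<lambda>v. {Inl v, Inr e}) ` ends G e"
    by (auto simp: subdivision_edges_def)
  show ?thesis using surj_card_le[OF fin sub] unfolding two .
next
  case False
  then have "{A \<in> subdivision_edges G. Inr e \<in> A} = {}" by (auto simp: subdivision_edges_def)
  then show ?thesis by (simp only: card.empty zero_le)
qed

lemma subdivision_decomp_exists:
  assumes G: "multigraph G" "max_degree G \<le> 2"
  shows "\<exists>Ps Cs. path_cycle_decomp (mverts G <+> medges G) (subdivision_edges G) Ps Cs"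
proof (rule path_cycle_decomp_exists)
  show fin: "finite (mverts G <+> medges G)" using G(1) by (simp add: multigraph_def)
  show edges: "A \<subseteq> mverts G <+> medges G \<and> card A = 2" if "A \<in> subdivision_edges G" for A
    using that G(1) by (auto simp: subdivision_edges_def multigraph_def)
  have "subdivision_edges G \<subseteq> Pow (mverts G <+> medges G)" using edges by blast
  then show "finite (subdivision_edges G)" 
    by (rule finite_subset) (simp only: finite_Pow_iff fin)
  show "card {A \<in> subdivision_edges G. x \<in> A} \<le> 2" if x: "x \<in> mverts G <+> medges G" for x
  proof (cases x)
    case (Inl v)
    then have "v \<in> mverts G" using x by auto
    from subdivision_degree_Inl[OF G(1), of v] degree_le_max_degree[OF G(1) this] G(2)
    have "card {A \<in> subdivision_edges G. Inl v \<in> A} \<le> 2" by linarith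
    then show ?thesis by (simp only: Inl)
  next
    case (Inr e)
    then show ?thesis using subdivision_degree_Inr[OF G(1), of e] by (simp only:)
  qed
qed

text \<open>Links join original vertices to middle vertices, so a cycle contains some
  \<open>Inl v\<close>, and its two links there come from different edges of \<open>G\<close> at
  \<open>v\<close>.\<close>

lemma subdivision_cycle_max_degree:
  assumes G: "multigraph G"
    and dec: "path_cycle_decomp (mverts G <+> medges G) (subdivision_edges G) Ps Cs" and C: "C \<in> set Cs"
  shows "2 \<le> max_degree G"
proof -
  have "distinct C" "3 \<le> length C" and sub: "clinks C \<subseteq> subdivision_edges G"
    using dec C by (auto simp: path_cycle_decomp_def distinct_concat_iff)
  have "C \<noteq> []" using \<open>3 \<le> length C\<close> by auto
  have "{last C, hd C} \<in> subdivision_edges G" using sub by (auto simp: clinks_def)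
  then obtain v where "Inl v = last C \<or> Inl v = hd C" by (auto simp: subdivision_edges_def doubleton_eq_iff)
  then have "Inl v \<in> set C" using \<open>C \<noteq> []\<close> by (metis last_in_set hd_in_set)
  from two_links_cycle[OF \<open>distinct C\<close> \<open>3 \<le> length C\<close> this]
  obtain A B where AB: "A \<in> clinks C" "B \<in> clinks C" "Inl v \<in> A" "Inl v \<in> B" "A \<noteq> B" by blast
  obtain e where e: "A = {Inl v, Inr e}" "e \<in> medges G" "v \<in> ends G e"
    using subsetD[OF sub AB(1)] AB(3) by (auto simp: subdivision_edges_def)
  obtain f where f: "B = {Inl v, Inr f}" "f \<in> medges G" "v \<in> ends G f"
    using subsetD[OF sub AB(2)] AB(4) by (auto simp: subdivision_edges_def)
  have "card {e, f} \<le> degree G v"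
    unfolding degree_def using e f G by (intro card_mono) (auto simp: multigraph_def)
  moreover have "e \<noteq> f" using e f AB(5) by auto
  moreover have "v \<in> mverts G" using e G by (auto simp: multigraph_def)
  ultimately show ?thesis using degree_le_max_degree[OF G, of v] by simp
qed

lemma subdivision_edge_max_degree:
  assumes G: "multigraph G" and "subdivision_edges G \<noteq> {}"
  shows "1 \<le> max_degree G"
proof -
  obtain v e where e: "e \<in> medges G" "v \<in> ends G e"
    using assms(2) by (auto simp: subdivision_edges_def)
  then have "card {e} \<le> degree G v"
    unfolding degree_def using G by (intro card_mono) (auto simp: multigraph_def)
  moreover have "v \<in> mverts G" using e G by (auto simp: multigraph_def)
  ultimately show ?thesis using degree_le_max_degree[OF G, of v] by simp
qed

text \<open>Passes from rounding up in the natural numbers to the real ceiling, for which m - 1 <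
  n/k is enough.\<close>

lemma le_ceiling_divide_nat:
  fixes m n k :: nat
  assumes "m \<le> (n + k - 1) div k" "0 < k"
  shows "int m \<le> \<lceil>real n / real k\<rceil>"
proof -
  have "m * k \<le> n + k - 1"
    using mult_le_mono1[OF assms(1), of k] div_times_less_eq_dividend le_trans by blast
  then have "m * k < n + k" using assms(2) by linarith
  then have "real m * real k < real n + real k" by (metis of_nat_add of_nat_less_iff of_nat_mult)
  then have "real m - 1 < real n / real k" using assms(2) by (simp add: field_simps)
  then show ?thesis by (simp add: le_ceiling_iff)
qed

lemma total_graph_equitably_choosable:
  fixes G :: "('v, 'e) mgraph"
  assumes G: "multigraph G" "max_degree G \<le> 2" and k: "max_degree G + 2 \<le> k"
  shows "equitably_choosable TYPE('c) (total_graph G) k"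
  unfolding equitably_choosable_def
proof (intro allI impI)
  fix L :: "'v + 'e \<Rightarrow> 'c set" assume L: "list_assignment_of_size (total_graph G) k L"
  let ?V = "mverts G <+> medges G" and ?E = "subdivision_edges G"
  have verts: "pverts (total_graph G) = ?V" by (simp add: total_graph_def Let_def)
  obtain Ps Cs where dec: "path_cycle_decomp ?V ?E Ps Cs" using subdivision_decomp_exists[OF G] by blast
  \<comment> \<open>The subdivision is bipartite: \<open>isl\<close> tells original vertices from
    middle vertices and alternates along each cycle.\<close>
  have evenC: "even (length C)" if "C \<in> set Cs" for C
  proof (rule even_length_alternating_cycle[of C isl])
    show "C \<noteq> []" using dec that by (auto simp: path_cycle_decomp_def)
    show "isl x \<longleftrightarrow> \<not> isl y" if "{x, y} \<in> clinks C" for x y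
    proof -
      have "{x, y} \<in> ?E" using dec that \<open>C \<in> set Cs\<close> by (auto simp: path_cycle_decomp_def)
      then show ?thesis by (auto simp: subdivision_edges_def doubleton_eq_iff)
    qed
  qed
  \<comment> \<open>A cycle forces maximum degree at least 2 and hence \<open>k \<ge> 4\<close>;
    without cycles, an edge still forces degree at least 1 and \<open>k \<ge> 3\<close>.\<close>
  have "4 \<le> k \<or> 3 \<le> k \<and> Cs = [] \<or> 1 \<le> k \<and> ?E = {}"
  proof (cases "Cs = []")
    case True
    then show ?thesis using subdivision_edge_max_degree[OF G(1)] k by linarith
  next
    case False
    then obtain C where "C \<in> set Cs" by (cases Cs) auto
    then show ?thesis using subdivision_cycle_max_degree[OF G(1) dec] k by fastforce
  qed
  then obtain f where f: "\<forall>v\<in>?V. f v \<in> L v" "\<forall>x\<in>?V. \<forall>y\<in>?V. adj2 ?E x y \<longrightarrow> f x \<noteq> f y"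
    "\<forall>c. card {v\<in>?V. f v = c} \<le> (card ?V + k - 1) div k"
    using equitable_square_colouring[OF dec evenC, of L k] L
    by (auto simp: list_assignment_of_size_def verts)
  have "f x \<noteq> f y" if "(x, y) \<in> parcs (total_graph G)" for x y
    using that f(2) total_adj_imp_adj2[of x G y] by (auto simp: total_graph_def Let_def)
  moreover have "int (card {v\<in>?V. f v = c}) \<le> \<lceil>real (card ?V) / real k\<rceil>" for c
    using f(3) k by (intro le_ceiling_divide_nat) auto
  ultimately have "equitable_list_coloring (total_graph G) k L f"
    using f(1) by (auto simp: equitable_list_coloring_def proper_list_coloring_def proper_coloring_def verts)
  then show "\<exists>f. equitable_list_coloring (total_graph G) k L f" by blast
qed

theorem theorem14:
  fixes G :: "('v, 'e) mgraph"
  assumes "multigraph G" and "max_degree G \<le> 2"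
  shows "(\<forall>k \<ge> max_degree G + 2. equitably_choosable TYPE('c) (total_graph G) k) \<and>
    (simple_mgraph G \<longrightarrow>
      (\<forall>k \<ge> max (list_chromatic_number (total_graph G)) (max_degree G + 2).
        equitably_choosable TYPE('c) (total_graph G) k))"
  \<comment> \<open>A \<open>k\<close> above the maximum is in particular at least
    \<open>max_degree G + 2\<close>, so the second claim is an instance of the first.\<close>
  using total_graph_equitably_choosable[OF assms] by (simp only: max.bounded_iff) blast

end
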